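(* Let $\mathbf k$ be an infinite field and let $\mathcal L\subseteq\mathbb Z^n$ be a sublattice of rank two. Then every monomial $\mathcal L$-graded ideal in $S=\mathbf k[x_1,\dots,x_n]$ has exactly two flips (counting both true flips and fake flips).
   Context: $S$ is graded by $G=\mathbb Z^n/\mathcal L$ via $\deg(x_i)=e_i+\mathcal L$; $G^+$ is the image of $\mathbb N^n$ in $G$. A homogeneous ideal $I\subseteq S$ is $\mathcal L$-graded if $\dim_{\mathbf k}((S/I)_g)=1$ for all $g\in G^+$. Flips: let $M$ be a monomial $\mathcal L$-graded ideal with minimal generator $x^u$, and let $x^v$ be the unique monomial not in $M$ of the same $\mathcal L$-degree as $x^u$. The wall ideal $W$ associated to $M$ and $x^u$ is the ideal obtained from the minimal monomial generating set of $M$ by replacing the generator $x^u$ by the binomial $x^u-x^v$. The binomial $x^u-x^v$ is flippable (a flip of $M$) if $in_{\prec}(W)=M$ for any term order $\prec$ with $x^v\prec x^u$. A flippable binomial $x^u-x^v$ is a true flip if there is some term order $\prec'$ with $x^u\prec' x^v$, and a fake flip if there is no such term order. (Term orders are monomial orders on $S$ with $1$ as smallest monomial.) The flips of $M$ are its flippable binomials, one for each minimal generator $x^u$ of $M$ such that $x^u-x^v$ is flippable. *)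

theory Defs
  imports
    "HOL-Analysis.Finite_Cartesian_Product"
    "HOL-Library.Poly_Mapping"
    "HOL-Library.Set_Algebras"
begin

(* Sublattices of Z^n are the Z-submodules of int^'n, ideals of a commutative ring are its
   submodules over itself. The locale "module" supplies subspace, span, independent for both. *)

interpretation int_lattice: module "(*s) :: int \<Rightarrow> int^'n \<Rightarrow> int^'n"
  by standard (simp_all add: vec_eq_iff distrib_left distrib_right mult.assoc)

interpretation ideal: module "(*) :: 'a::comm_ring_1 \<Rightarrow> 'a \<Rightarrow> 'a"
  by standard (simp_all add: distrib_left distrib_right mult.assoc)

definition sublattice_of_rank :: "(int^'n) set \<Rightarrow> nat \<Rightarrow> bool" where
  "sublattice_of_rank L r \<longleftrightarrow>
     (\<exists>B. finite B \<and> card B = r \<and> int_lattice.independent B \<and> int_lattice.span B = L)"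

(* k[x_1, ..., x_n]: finitely supported functions from exponent vectors in N^n to k,
   with the convolution product of Poly_Mapping. *)

type_synonym ('n, 'k) mpoly = "(nat, 'n) vec \<Rightarrow>\<^sub>0 'k"

definition monom :: "nat^'n \<Rightarrow> ('n::finite, 'k::comm_ring_1) mpoly" where
  "monom u = Poly_Mapping.single u 1"

definition const :: "'k::comm_ring_1 \<Rightarrow> ('n::finite, 'k) mpoly" where
  "const c = Poly_Mapping.single 0 c"

(* An element of Z^n/L is represented as a coset of L. As deg(x_i) = e_i + L,
   the degree of the monomial x^u is u + L. *)

definition mdeg :: "(int^'n) set \<Rightarrow> nat^'n \<Rightarrow> (int^'n) set" where
  "mdeg L u = (\<chi> i. int (u $ i)) +o L"

definition Gplus :: "(int^'n) set \<Rightarrow> (int^'n) set set" where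
  "Gplus L = range (mdeg L)"

definition graded_piece :: "(int^'n) set \<Rightarrow> (int^'n) set \<Rightarrow> ('n::finite, 'k::comm_ring_1) mpoly set" where
  "graded_piece L g = {f. \<forall>u \<in> Poly_Mapping.keys f. mdeg L u = g}"

definition homogeneous_ideal :: "(int^'n) set \<Rightarrow> ('n::finite, 'k::comm_ring_1) mpoly set \<Rightarrow> bool" where
  "homogeneous_ideal L I \<longleftrightarrow> (\<exists>F \<subseteq> (\<Union>g. graded_piece L g). I = ideal.span F)"

(* The image of the k-subspace V in the quotient S/I has dimension d: the finite set B consists of
   representatives of a basis of that image. Independence modulo I makes B inject into S/I. *)

definition dim_mod :: "('n::finite, 'k::field) mpoly set \<Rightarrow> ('n, 'k) mpoly set \<Rightarrow> nat \<Rightarrow> bool" where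
  "dim_mod V I d \<longleftrightarrow>
     (\<exists>B \<subseteq> V. finite B \<and> card B = d \<and>
        (\<forall>c. (\<Sum>b\<in>B. const (c b) * b) \<in> I \<longrightarrow> (\<forall>b\<in>B. c b = 0)) \<and>
        (\<forall>f\<in>V. \<exists>c. f - (\<Sum>b\<in>B. const (c b) * b) \<in> I))"

definition L_graded :: "(int^'n) set \<Rightarrow> ('n::finite, 'k::field) mpoly set \<Rightarrow> bool" where
  "L_graded L I \<longleftrightarrow>
     homogeneous_ideal L I \<and> (\<forall>g \<in> Gplus L. dim_mod (graded_piece L g) I 1)"

definition monomial_ideal :: "('n::finite, 'k::comm_ring_1) mpoly set \<Rightarrow> bool" where
  "monomial_ideal M \<longleftrightarrow> (\<exists>A. M = ideal.span (monom ` A))"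

definition is_min_gens :: "('n::finite, 'k::comm_ring_1) mpoly set \<Rightarrow> (nat^'n) set \<Rightarrow> bool" where
  "is_min_gens M A \<longleftrightarrow>
     ideal.span (monom ` A) = M \<and> (\<forall>A'. A' \<subset> A \<longrightarrow> ideal.span (monom ` A') \<noteq> M)"

(* Well defined for monomial ideals: see ex1_min_gens below. *)

definition min_gens :: "('n::finite, 'k::comm_ring_1) mpoly set \<Rightarrow> (nat^'n) set" where
  "min_gens M = (THE A. is_min_gens M A)"

(* lt is the strict order of a term order. *)

definition term_order :: "(nat^'n \<Rightarrow> nat^'n \<Rightarrow> bool) \<Rightarrow> bool" where
  "term_order lt \<longleftrightarrow>
     irreflp lt \<and> transp lt \<and> totalp lt \<and>
     (\<forall>u. u \<noteq> 0 \<longrightarrow> lt 0 u) \<and> (\<forall>u v w. lt u v \<longrightarrow> lt (u + w) (v + w))"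

definition is_leading_exp ::
    "(nat^'n \<Rightarrow> nat^'n \<Rightarrow> bool) \<Rightarrow> ('n::finite, 'k::comm_ring_1) mpoly \<Rightarrow> nat^'n \<Rightarrow> bool" where
  "is_leading_exp lt f u \<longleftrightarrow>
     u \<in> Poly_Mapping.keys f \<and> (\<forall>w \<in> Poly_Mapping.keys f. w \<noteq> u \<longrightarrow> lt w u)"

definition initial_ideal ::
    "(nat^'n \<Rightarrow> nat^'n \<Rightarrow> bool) \<Rightarrow> ('n::finite, 'k::comm_ring_1) mpoly set \<Rightarrow> ('n, 'k) mpoly set" where
  "initial_ideal lt I = ideal.span (monom ` {u. \<exists>f\<in>I. is_leading_exp lt f u})"

definition wall_ideal ::
    "('n::finite, 'k::comm_ring_1) mpoly set \<Rightarrow> nat^'n \<Rightarrow> nat^'n \<Rightarrow> ('n, 'k) mpoly set" where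
  "wall_ideal M u v =
     ideal.span (monom ` (min_gens M - {u}) \<union> {monom u - monom v})"

definition flippable :: "('n::finite, 'k::comm_ring_1) mpoly set \<Rightarrow> nat^'n \<Rightarrow> nat^'n \<Rightarrow> bool" where
  "flippable M u v \<longleftrightarrow>
     (\<forall>lt. term_order lt \<and> lt v u \<longrightarrow> initial_ideal lt (wall_ideal M u v) = M)"

definition is_flip ::
    "(int^'n) set \<Rightarrow> ('n::finite, 'k::comm_ring_1) mpoly set \<Rightarrow> nat^'n \<Rightarrow> nat^'n \<Rightarrow> bool" where
  "is_flip L M u v \<longleftrightarrow>
     u \<in> min_gens M \<and> monom v \<notin> M \<and> mdeg L v = mdeg L u \<and> flippable M u v"

definition flips ::
    "(int^'n) set \<Rightarrow> ('n::finite, 'k::comm_ring_1) mpoly set \<Rightarrow> ('n, 'k) mpoly set" where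
  "flips L M = {monom u - monom v | u v. is_flip L M u v}"

definition true_flips ::
    "(int^'n) set \<Rightarrow> ('n::finite, 'k::comm_ring_1) mpoly set \<Rightarrow> ('n, 'k) mpoly set" where
  "true_flips L M =
     {monom u - monom v | u v. is_flip L M u v \<and> (\<exists>lt. term_order lt \<and> lt u v)}"

definition fake_flips ::
    "(int^'n) set \<Rightarrow> ('n::finite, 'k::comm_ring_1) mpoly set \<Rightarrow> ('n, 'k) mpoly set" where
  "fake_flips L M =
     {monom u - monom v | u v. is_flip L M u v \<and> \<not> (\<exists>lt. term_order lt \<and> lt u v)}"

lemma flips_true_fake: "flips L M = true_flips L M \<union> fake_flips L M"
proof
  show "flips L M \<subseteq> true_flips L M \<union> fake_flips L M"
  proof
    fix f assume "f \<in> flips L M"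
    then obtain u v where "is_flip L M u v" "f = monom u - monom v"
      unfolding flips_def by blast
    then show "f \<in> true_flips L M \<union> fake_flips L M"
      unfolding true_flips_def fake_flips_def
      by (cases "\<exists>lt. term_order lt \<and> lt u v") blast+
  qed
qed (auto simp: flips_def true_flips_def fake_flips_def)

lemma monom_in_span_iff:
  fixes A :: "(nat^'n::finite) set"
  shows "(monom u :: ('n, 'k::comm_ring_1) mpoly) \<in> ideal.span (monom ` A) \<longleftrightarrow> (\<exists>a\<in>A. a \<le> u)"
proof
  let ?T = "{f :: ('n, 'k) mpoly. \<forall>u \<in> Poly_Mapping.keys f. \<exists>a\<in>A. a \<le> u}"
  have "ideal.subspace ?T"
  proof (rule ideal.subspaceI)
    show "f + g \<in> ?T" if "f \<in> ?T" "g \<in> ?T" for f g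
      using that keys_add[of f g] by blast
    show "c * f \<in> ?T" if f: "f \<in> ?T" for c f
    proof (rule CollectI, rule ballI)
      fix u assume "u \<in> Poly_Mapping.keys (c * f)"
      then obtain b w where u: "u = b + w" and "w \<in> Poly_Mapping.keys f"
        using keys_mult[of c f] by blast
      with f obtain a where "a \<in> A" "a \<le> w" by blast
      moreover from this u have "a \<le> u" by (simp add: less_eq_vec_def trans_le_add2)
      ultimately show "\<exists>a\<in>A. a \<le> u" by blast
    qed
  qed simp
  moreover have "monom ` A \<subseteq> ?T" by (auto simp: monom_def)
  ultimately have "ideal.span (monom ` A) \<subseteq> ?T" by (rule ideal.span_minimal[rotated])
  moreover assume "(monom u :: ('n, 'k) mpoly) \<in> ideal.span (monom ` A)"
  ultimately show "\<exists>a\<in>A. a \<le> u" by (auto simp: monom_def)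
next
  assume "\<exists>a\<in>A. a \<le> u"
  then obtain a where a: "a \<in> A" "a \<le> u" by blast
  have "(u - a) + a = u" using a(2) by (simp add: vec_eq_iff less_eq_vec_def)
  then have "(monom u :: ('n, 'k) mpoly) = monom (u - a) * monom a"
    by (simp add: monom_def mult_single)
  then show "(monom u :: ('n, 'k) mpoly) \<in> ideal.span (monom ` A)"
    using a(1) by (simp add: ideal.span_base ideal.span_scale)
qed

lemma ex_minimal_below:
  fixes u :: "nat^'n::finite"
  assumes "u \<in> A"
  shows "\<exists>m\<in>A. m \<le> u \<and> (\<forall>a\<in>A. a \<le> m \<longrightarrow> a = m)"
proof -
  let ?s = "\<lambda>u :: nat^'n. \<Sum>i\<in>UNIV. u $ i"
  obtain m where m: "m \<in> A" "m \<le> u" and least: "\<And>a. a \<in> A \<Longrightarrow> a \<le> u \<Longrightarrow> ?s m \<le> ?s a"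
    using ex_has_least_nat[of "\<lambda>a. a \<in> A \<and> a \<le> u" u ?s] assms by auto
  have "a = m" if "a \<in> A" "a \<le> m" for a
  proof (rule ccontr)
    assume "a \<noteq> m"
    then obtain j where "a $ j \<noteq> m $ j" by (auto simp: vec_eq_iff)
    with \<open>a \<le> m\<close> have "a $ j < m $ j" by (simp add: less_eq_vec_def le_neq_implies_less)
    then have "?s a < ?s m"
      using \<open>a \<le> m\<close> by (intro sum_strict_mono_ex1) (auto simp: less_eq_vec_def)
    moreover have "?s m \<le> ?s a" using that m(2) by (intro least) (auto intro: order_trans)
    ultimately show False by simp
  qed
  with m show ?thesis by blast
qed

lemma ex1_min_gens:
  fixes M :: "('n::finite, 'k::comm_ring_1) mpoly set"
  assumes "monomial_ideal M"
  shows "\<exists>!A. is_min_gens M A"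
proof -
  let ?mono = "monom :: nat^'n \<Rightarrow> ('n, 'k) mpoly"
  obtain A where M: "M = ideal.span (?mono ` A)"
    using assms by (auto simp: monomial_ideal_def)
  define N where "N = {m \<in> A. \<forall>a\<in>A. a \<le> m \<longrightarrow> a = m}"
  have below: "\<exists>m\<in>N. m \<le> a" if "a \<in> A" for a
    using ex_minimal_below[OF that] by (auto simp: N_def)
  have "?mono ` A \<subseteq> ideal.span (?mono ` N)"
    using below by (auto simp: monom_in_span_iff)
  then have "M \<subseteq> ideal.span (?mono ` N)"
    unfolding M by (rule ideal.span_minimal) simp
  moreover have "ideal.span (?mono ` N) \<subseteq> M"
    unfolding M by (rule ideal.span_mono) (auto simp: N_def)
  ultimately have N: "ideal.span (?mono ` N) = M" by blast
  have least: "N \<subseteq> C" if C: "ideal.span (?mono ` C) = M" for C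
  proof
    fix m assume m: "m \<in> N"
    then have "?mono m \<in> ideal.span (?mono ` C)"
      unfolding C N[symmetric] by (intro ideal.span_base imageI)
    then obtain c where c: "c \<in> C" "c \<le> m" unfolding monom_in_span_iff by blast
    then have "?mono c \<in> ideal.span (?mono ` N)"
      unfolding N C[symmetric] by (intro ideal.span_base imageI)
    then obtain m' where m': "m' \<in> N" "m' \<le> c" unfolding monom_in_span_iff by blast
    have "m' \<le> m" using m'(2) c(2) by (rule order_trans)
    with m m'(1) have "m' = m" unfolding N_def by blast
    with m'(2) c(2) have "c = m" by (metis order_antisym)
    with c(1) show "m \<in> C" by simp
  qed
  show ?thesis
  proof (rule ex1I)
    show "is_min_gens M N"
      unfolding is_min_gens_def using N least by blast
    show "C = N" if "is_min_gens M C" for C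
      using that N least[of C] unfolding is_min_gens_def by blast
  qed
qed

end

theory Submission
  imports Defs
begin

text \<open>
  Write N for the set of exponents of standard monomials and \<open>z\<^sup>+\<close>, \<open>z\<^sup>-\<close> for the positive and negative
  part of z. All data are encoded in the set D of lattice vectors z with \<open>z\<^sup>+\<close> in N: every minimal
  generator is \<open>z\<^sup>-\<close> for some z in D, and its standard partner is then \<open>z\<^sup>+\<close>. As L has rank two, D
  contains a lattice basis p, q. No nonzero vector of the opposite cone lies in D, and as long as
  some coordinate is negative on both p and q, one of q - p, p - q is again in D, so that
  the basis can be replaced by one spanning a larger cone. In the end \<open>p\<^sup>-\<close> and \<open>q\<^sup>-\<close> have disjoint supports, and
  then D lies in the cone spanned by p and q. The two extreme vectors give the two flips. Every
  other minimal generator belongs to a sum m + m' of two vectors of D forming a basis; its wall ideal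
  contains a standard monomial, namely the one with exponent the componentwise maximum of 0, m', m + m'.
\<close>

section \<open>Choice functions on rank two lattices\<close>

text \<open>No weight vector or term order selects the standard monomials, so D has no linear
  structure to start from and need not be closed under addition. The handle on it is a box: bound
  the lattice points by a componentwise maximum of a few known vectors and let t be the standard
  point. Every y in the box satisfies y - t in D, hence t - y is not in D unless y = t, and
  \<open>D_down\<close> turns each such non-membership into a strict coordinate inequality.
  \<open>superbase\<close>, \<open>gap\<close> and \<open>extend\<close> choose a box in this way
  and exclude signs of the coordinates of t in a basis; rank two leaves few sign patterns. Whether p
  + q lies in D drives the Euclidean descents on coefficient pairs: if it does, the cone is cut
  along p + q; if not, the negative supports of p and q are nested, which makes p or q comparable
  with the vector under study. Flippability quantifies over all term orders with x^v smaller than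
  x^u, so refuting it also requires exhibiting such an order.\<close>

lemma nonneg_comb_pos:
  fixes x y d e :: int
  assumes "0 < d" "0 < e" "0 \<le> x * d + y * e" "(x, y) \<noteq> (0, 0)"
  shows "0 < x \<or> 0 < y"
proof (rule ccontr)
  assume "\<not> (0 < x \<or> 0 < y)"
  then have xy: "x \<le> 0" "y \<le> 0" by auto
  then have "x * d \<le> 0" "y * e \<le> 0" using assms(1,2) by (auto simp: mult_le_0_iff)
  with assms(3) have "x * d = 0" "y * e = 0" by linarith+
  with assms(1,2,4) show False by simp
qed

lemma nonneg_comb_ge:
  fixes x y d e :: int
  assumes "0 < d" "0 < e" "0 \<le> x" "0 \<le> y" "1 \<le> x + y"
  shows "d \<le> x * d + y * e \<or> e \<le> x * d + y * e"
proof (cases "1 \<le> x")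
  case True
  then have "1 * d \<le> x * d" using assms by (intro mult_right_mono) auto
  moreover have "0 \<le> y * e" using assms by simp
  ultimately show ?thesis by linarith
next
  case False
  then have "1 * e \<le> y * e" using assms by (intro mult_right_mono) auto
  moreover have "0 \<le> x * d" using assms by simp
  ultimately show ?thesis by linarith
qed

lemma le_of_comb_le:
  fixes x y d q :: int
  assumes "q < d" "0 < d" "0 \<le> x" "0 \<le> y" "x * d \<le> y * q"
  shows "x < y \<or> x = 0 \<and> (y = 0 \<or> 0 \<le> q)"
proof (cases "x = 0")
  case True
  then show ?thesis using assms by (auto simp: zero_le_mult_iff)
next
  case False
  with assms have "0 < y * q" by (smt (verit) mult_pos_pos)
  with assms have "0 < y" "0 < q" by (auto simp: zero_less_mult_iff)
  then have "y * q < y * d" using assms by simp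
  with assms have "x * d < y * d" by linarith
  with assms show ?thesis by simp
qed

text \<open>Coordinate bounds for \<open>no_mixed_choice\<close>: if t = a p + c q lies below max(p,
  q), this one puts t - p below max(0, q), and \<open>mixed_bound2\<close> puts t - q below max(0,
  p).\<close>

lemma mixed_bound1:
  fixes a c p q :: int
  assumes "c < 0" "- c \<le> a - 1" "a * p + c * q \<le> max p q"
  shows "(a - 1) * p + c * q \<le> max 0 q"
proof -
  have eq: "(a - 1) * p + c * q = a * p + c * q - p" by (simp add: algebra_simps)
  consider "0 \<le> p \<or> q \<le> p" | "p < 0" "0 \<le> q" | "p < q" "q < 0" by linarith
  then show ?thesis
  proof cases
    case 1
    then show ?thesis using eq assms(3) by auto
  next
    case 2
    then have "(a - 1) * p \<le> 0" "c * q \<le> 0" using assms by (auto simp: mult_le_0_iff)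
    then show ?thesis by linarith
  next
    case 3
    have "(a - 1) * p \<le> (- c) * p" using 3 assms by (intro mult_right_mono_neg) auto
    moreover have "(- c) * p \<le> (- c) * q" using 3 assms by (intro mult_left_mono) auto
    ultimately show ?thesis by simp
  qed
qed

lemma mixed_bound2:
  fixes a c p q :: int
  assumes "0 < a" "a \<le> - c" "a * p + c * q \<le> max p q"
  shows "a * p + (c - 1) * q \<le> max 0 p"
proof -
  have eq: "a * p + (c - 1) * q = a * p + c * q - q" by (simp add: algebra_simps)
  consider "p \<le> q \<or> 0 \<le> q" | "q < 0" "q < p" by linarith
  then show ?thesis
  proof cases
    case 1
    then show ?thesis using eq assms(3) by auto
  next
    case 2
    have "a * (- q) \<le> (- c) * (- q)" using 2 assms by (intro mult_right_mono) auto
    moreover have "1 * (p - q) \<le> a * (p - q)" using 2 assms by (intro mult_right_mono) auto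
    ultimately have "p - q \<le> a * p + c * q" by (simp add: algebra_simps)
    with assms 2 show ?thesis by simp
  qed
qed

text \<open>If the negative support of r is contained in that of s, this is the hypothesis of
  \<open>D_down\<close> for passing from -(k r + l s) to -r.\<close>

lemma neg_le_neg_comb:
  fixes r s k l :: int
  assumes "r < 0 \<Longrightarrow> s < 0" "1 \<le> k" "0 \<le> l"
  shows "- r \<le> max 0 (- (k * r + l * s))"
proof (cases "r < 0")
  case True
  then have "k * r \<le> 1 * r" "l * s \<le> 0"
    using assms by (auto intro!: mult_right_mono_neg simp: mult_le_0_iff)
  then show ?thesis by simp
qed simp

text \<open>The set of lattice points below w is the set of monomials of one degree, the point y standing
  for the monomial with exponent w - y; the assumption \<open>choice\<close> expresses that the one at q is
  standard.\<close>

locale lattice_choice =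
  fixes L D :: "(int^'n::finite) set"
  assumes zero_L: "0 \<in> L"
    and add_L: "x \<in> L \<Longrightarrow> y \<in> L \<Longrightarrow> x + y \<in> L"
    and smult_L: "x \<in> L \<Longrightarrow> k *s x \<in> L"
    and D_L: "z \<in> D \<Longrightarrow> z \<in> L"
    and D_down: "p \<in> D \<Longrightarrow> y \<in> L \<Longrightarrow> (\<And>i. y $ i \<le> max 0 (p $ i)) \<Longrightarrow> y \<in> D"
    and D_antisym: "z \<in> D \<Longrightarrow> - z \<in> D \<Longrightarrow> z = 0"
    and choice: "x \<in> L \<Longrightarrow> (\<And>i. x $ i \<le> w $ i) \<Longrightarrow>
      \<exists>q\<in>L. (\<forall>i. q $ i \<le> w $ i) \<and> (\<forall>y\<in>L. (\<forall>i. y $ i \<le> w $ i) \<longrightarrow> y - q \<in> D)"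
begin

lemma uminus_L: "x \<in> L \<Longrightarrow> - x \<in> L"
  using smult_L[of x "-1"] by (simp add: vec_eq_iff scalar_mult_eq_scaleR)

lemma diff_L: "x \<in> L \<Longrightarrow> y \<in> L \<Longrightarrow> x - y \<in> L"
  using add_L[of x "- y"] uminus_L[of y] by simp

lemma exceeds:
  assumes "p \<in> D" "y \<in> L" "y \<notin> D"
  shows "\<exists>i. max 0 (p $ i) < y $ i"
  using D_down[OF assms(1,2)] assms(3) by (meson not_le)

lemma choice2:
  assumes "x \<in> L"
  obtains t where "t \<in> L" "\<And>i. t $ i \<le> max (x $ i) (y $ i)"
    "\<And>u. u \<in> L \<Longrightarrow> (\<And>i. u $ i \<le> max (x $ i) (y $ i)) \<Longrightarrow> u - t \<in> D"
proof -
  let ?w = "\<chi> i. max (x $ i) (y $ i)"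
  have "x $ i \<le> ?w $ i" for i by simp
  from choice[OF assms this] obtain t where "t \<in> L" "\<forall>i. t $ i \<le> ?w $ i"
    "\<forall>y\<in>L. (\<forall>i. y $ i \<le> ?w $ i) \<longrightarrow> y - t \<in> D" by blast
  then show thesis by (intro that[of t]) auto
qed

lemma choice3:
  assumes "x \<in> L"
  obtains t where "t \<in> L" "\<And>i. t $ i \<le> max (max (x $ i) (y $ i)) (z $ i)"
    "\<And>u. u \<in> L \<Longrightarrow> (\<And>i. u $ i \<le> max (max (x $ i) (y $ i)) (z $ i)) \<Longrightarrow> u - t \<in> D"
proof -
  let ?w = "\<chi> i. max (max (x $ i) (y $ i)) (z $ i)"
  have "x $ i \<le> ?w $ i" for i by simp
  from choice[OF assms this] obtain t where "t \<in> L" "\<forall>i. t $ i \<le> ?w $ i"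
    "\<forall>y\<in>L. (\<forall>i. y $ i \<le> ?w $ i) \<longrightarrow> y - t \<in> D" by blast
  then show thesis by (intro that[of t]) auto
qed

section \<open>Bases of the lattice and their elementary changes\<close>

definition basis :: "int^'n \<Rightarrow> int^'n \<Rightarrow> bool" where
  "basis p q \<longleftrightarrow> p \<in> L \<and> q \<in> L \<and> (\<forall>z\<in>L. \<exists>a c. z = a *s p + c *s q) \<and>
     (\<forall>a c. a *s p + c *s q = 0 \<longrightarrow> a = 0 \<and> c = 0)"

lemma basis_commute: "basis p q \<Longrightarrow> basis q p"
  unfolding basis_def add.commute[of "_ *s p"] by blast

lemma basis_coords:
  assumes "basis p q" "z \<in> L"
  obtains a c where "z = a *s p + c *s q"
  using assms by (auto simp: basis_def)

lemma basis_zero: "basis p q \<Longrightarrow> a *s p + c *s q = 0 \<Longrightarrow> a = 0 \<and> c = 0"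
  by (simp add: basis_def)

lemma basis_nonzero: "basis p q \<Longrightarrow> p \<noteq> 0" "basis p q \<Longrightarrow> q \<noteq> 0"
  using basis_zero[of p q 1 0] basis_zero[of p q 0 1] by (auto simp: vec_eq_iff)

lemma basis_add:
  assumes "basis p q" shows "basis p (k *s p + q)"
  unfolding basis_def
proof (intro conjI ballI allI impI)
  show "p \<in> L" "k *s p + q \<in> L" using assms by (auto simp: basis_def add_L smult_L)
  fix z assume "z \<in> L"
  then obtain a c where "z = a *s p + c *s q" using assms basis_coords by blast
  then have "z = (a - c * k) *s p + c *s (k *s p + q)"
    by (simp add: vec_eq_iff algebra_simps)
  then show "\<exists>a c. z = a *s p + c *s (k *s p + q)" by blast
next
  fix a c assume "a *s p + c *s (k *s p + q) = 0"
  moreover have "(a + c * k) *s p + c *s q = a *s p + c *s (k *s p + q)"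
    by (simp add: vec_eq_iff algebra_simps)
  ultimately have "(a + c * k) *s p + c *s q = 0" by simp
  from basis_zero[OF assms this] have "a + c * k = 0" "c = 0" by blast+
  then show "a = 0" "c = 0" by simp_all
qed

lemma basis_add1: "basis p q \<Longrightarrow> basis p (p + q)"
  using basis_add[of p q 1] by (simp add: vec_eq_iff)

lemma basis_add2: "basis p q \<Longrightarrow> basis (p + q) q"
  using basis_add1[of q p] by (metis add.commute basis_commute)

lemma basis_diff: "basis p q \<Longrightarrow> basis p (q - p)"
  using basis_add[of p q "-1"] by (simp add: vec_eq_iff)

lemma basis_L: "basis p q \<Longrightarrow> p \<in> L" "basis p q \<Longrightarrow> q \<in> L" "basis p q \<Longrightarrow> p + q \<in> L"
  by (auto simp: basis_def add_L)

section \<open>The cone opposite to a basis contained in D\<close>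

lemma basis_exceeds:
  assumes "basis p q" "p \<in> D" "q \<in> D"
  shows "\<exists>i. max 0 (q $ i) < - p $ i"
proof -
  have "- p \<notin> D" using D_antisym[OF assms(2)] basis_nonzero[OF assms(1)] by blast
  from exceeds[OF assms(3) uminus_L[OF D_L[OF assms(2)]] this] show ?thesis by simp
qed

text \<open>Otherwise 0, p, p + q form a directed cycle of steps in D. The standard point t of the
  box around this triangle is then no vertex, and all three barycentric coordinates of t come out
  positive, impossible for integers with sum 1.\<close>

lemma superbase:
  assumes b: "basis p q" and p: "p \<in> D" and q: "q \<in> D"
  shows "- (p + q) \<notin> D"
proof
  assume m: "- (p + q) \<in> D"
  note pL = D_L[OF p] and qL = D_L[OF q] and PL = basis_L(3)[OF b]
  have pq: "p \<noteq> 0" "q \<noteq> 0" "p + q \<noteq> 0"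
    using basis_nonzero[OF b] basis_nonzero[OF basis_add1[OF b]] by auto
  obtain t where t: "t \<in> L" "\<And>i. t $ i \<le> max (max 0 (p $ i)) ((p + q) $ i)"
    and T: "\<And>y. y \<in> L \<Longrightarrow> (\<And>i. y $ i \<le> max (max 0 (p $ i)) ((p + q) $ i)) \<Longrightarrow> y - t \<in> D"
    using choice3[OF zero_L, of p "p + q"] unfolding zero_index by blast
  have nt: "- t \<in> D" "p - t \<in> D" "p + q - t \<in> D"
    using T[of 0] T[of p] T[of "p + q"] zero_L pL PL by (auto simp: le_max_iff_disj)
  have ne: "t \<noteq> 0" "t \<noteq> p" "t \<noteq> p + q"
    using nt D_antisym[of "p + q"] m D_antisym[OF p] D_antisym[OF q] pq by auto
  obtain a c where ac: "t = a *s p + c *s q" using basis_coords[OF b t(1)] .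
  have tle: "a * p $ i + c * q $ i \<le> max (max 0 (p $ i)) (p $ i + q $ i)" for i
    using t(2)[of i] by (simp add: ac)
  \<comment> \<open>At i0, i1, i2 the strict maximum among the vertices is 0, p, p + q
    respectively.\<close>
  obtain i0 where i0: "max 0 (q $ i0) < - p $ i0" using basis_exceeds[OF b p q] by blast
  obtain i1 where i1: "max 0 (- (p $ i1 + q $ i1)) < - q $ i1"
    using exceeds[OF m uminus_L[OF qL]] D_antisym[OF q] pq by (auto simp: less_max_iff_disj)
  obtain i2 where i2: "max 0 (p $ i2) < p $ i2 + q $ i2"
    using exceeds[OF p PL] D_antisym[of "p + q"] m pq by auto
  \<comment> \<open>At each of j0, j1, j2 the point t lies strictly above both ends of one edge of
    the triangle: 0 and p, then p and p + q, then p + q and 0.\<close>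
  have "t \<notin> D" using D_antisym nt ne by blast
  then obtain j0 where j0: "max 0 (p $ j0) < a * p $ j0 + c * q $ j0"
    using exceeds[OF p t(1)] by (auto simp: ac)
  have "t - p \<notin> D" using D_antisym[OF nt(2)] ne by auto
  then obtain j1 where j1: "max 0 (q $ j1) < (a - 1) * p $ j1 + c * q $ j1"
    using exceeds[OF q diff_L[OF t(1) pL]] by (auto simp: ac algebra_simps)
  have "t - (p + q) \<notin> D" using D_antisym[OF nt(3)] ne by auto
  then obtain j2 where j2: "max 0 (- (p $ j2 + q $ j2)) < (a - 1) * p $ j2 + (c - 1) * q $ j2"
    using exceeds[OF m diff_L[OF t(1) PL]] by (auto simp: ac algebra_simps)
  \<comment> \<open>1 - a, a - c, c are the barycentric coordinates of t with respect to 0, p, p + q.\<close>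
  have tle0: "0 \<le> (a - c) * (- p $ i0) + c * (- (p $ i0 + q $ i0))"
    using tle[of i0] i0 by (auto simp: algebra_simps max_def split: if_splits)
  have "(a - c, c) \<noteq> (0, 0)" using ne(1) by (auto simp: ac)
  then have c0: "0 < a - c \<or> 0 < c" using i0 by (intro nonneg_comb_pos[OF _ _ tle0]) auto
  have tle1: "0 \<le> (1 - a) * p $ i1 + c * (- q $ i1)"
    using tle[of i1] i1 by (auto simp: algebra_simps max_def split: if_splits)
  have "(1 - a, c) \<noteq> (0, 0)" using ne(2) by (auto simp: ac)
  then have c1: "0 < 1 - a \<or> 0 < c" using i1 by (intro nonneg_comb_pos[OF _ _ tle1]) auto
  have tle2: "0 \<le> (1 - a) * (p $ i2 + q $ i2) + (a - c) * q $ i2"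
    using tle[of i2] i2 by (auto simp: algebra_simps max_def split: if_splits)
  have "(1 - a, a - c) \<noteq> (0, 0)" using ne(3) by (auto simp: ac vec_eq_iff)
  then have c2: "0 < 1 - a \<or> 0 < a - c" using i2 by (intro nonneg_comb_pos[OF _ _ tle2]) auto
  \<comment> \<open>By c0, c1, c2 at most one barycentric coordinate is nonpositive. If it is c,
    then (p + q) - t is a nonnegative combination of p + q and q, both positive at j0, which pushes
    t down to 0 or p there. The other two coordinates are treated in the same way at j1 and
    j2.\<close>
  have "0 < c"
  proof (rule ccontr)
    assume "\<not> 0 < c"
    with c0 c1 have "0 \<le> 1 - a" "0 \<le> a - c" "1 \<le> (1 - a) + (a - c)" by auto
    moreover have "0 < p $ j0 + q $ j0" "0 < q $ j0"
      using tle[of j0] j0 by (auto simp: max_def split: if_splits)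
    ultimately show False
      using nonneg_comb_ge[of "p $ j0 + q $ j0" "q $ j0" "1 - a" "a - c"] j0
      by (auto simp: algebra_simps max_def split: if_splits)
  qed
  moreover have "0 < 1 - a"
  proof (rule ccontr)
    assume "\<not> 0 < 1 - a"
    with c1 c2 have "0 \<le> a - c" "0 \<le> c" "1 \<le> (a - c) + c" by auto
    moreover have "0 < - p $ j1" "0 < - (p $ j1 + q $ j1)"
      using tle[of j1] j1 by (auto simp: algebra_simps max_def split: if_splits)
    ultimately show False
      using nonneg_comb_ge[of "- p $ j1" "- (p $ j1 + q $ j1)" "a - c" c] j1
      by (auto simp: algebra_simps max_def split: if_splits)
  qed
  moreover have "0 < a - c"
  proof (rule ccontr)
    assume "\<not> 0 < a - c"
    with c0 c2 have "0 \<le> 1 - a" "0 \<le> c" "1 \<le> (1 - a) + c" by auto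
    moreover have "0 < p $ j2" "0 < - q $ j2"
      using tle[of j2] j2 by (auto simp: algebra_simps max_def split: if_splits)
    ultimately show False
      using nonneg_comb_ge[of "p $ j2" "- q $ j2" "1 - a" c] j2
      by (auto simp: algebra_simps max_def split: if_splits)
  qed
  ultimately show False by linarith
qed

lemma neg_multiple:
  assumes "p \<in> D" "p \<noteq> 0" "1 \<le> k"
  shows "- (k *s p) \<notin> D"
proof
  assume k: "- (k *s p) \<in> D"
  have "- p $ i \<le> max 0 (- (k * p $ i))" for i
    using neg_le_neg_comb[of "p $ i" "p $ i" k 0] assms(3) by simp
  then have "- p \<in> D" using D_down[OF k uminus_L[OF D_L[OF assms(1)]]] by simp
  with D_antisym assms show False by blast
qed

text \<open>Since neither p + q nor its negative lies in D, the standard point t of the box max(0, p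
  + q) is neither 0 nor p + q. Coordinates of t with equal signs contradict each other. If x is
  positive and y negative, a coordinate with q negative and p nonnegative would give t at least p -
  q, outside the box; this yields the inclusion of supports.\<close>

lemma gap:
  assumes b: "basis p q" and p: "p \<in> D" and q: "q \<in> D" and P: "p + q \<notin> D"
  shows "(\<forall>i. q $ i < 0 \<longrightarrow> p $ i < 0) \<or> (\<forall>i. p $ i < 0 \<longrightarrow> q $ i < 0)"
proof -
  note pL = D_L[OF p] and qL = D_L[OF q] and PL = basis_L(3)[OF b]
  obtain t where t: "t \<in> L" "\<And>i. t $ i \<le> max (0 $ i) ((p + q) $ i)"
    and T: "\<And>y. y \<in> L \<Longrightarrow> (\<And>i. y $ i \<le> max (0 $ i) ((p + q) $ i)) \<Longrightarrow> y - t \<in> D"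
    using choice2[OF zero_L, of "p + q"] by blast
  have nt: "- t \<in> D" "p + q - t \<in> D"
    using T[of 0] T[of "p + q"] zero_L PL by auto
  have ne: "t \<noteq> 0" "t \<noteq> p + q"
    using nt P superbase[OF b p q] by auto
  obtain x y where xy: "t = x *s p + y *s q" using basis_coords[OF b t(1)] .
  have tle: "x * p $ i + y * q $ i \<le> max 0 (p $ i + q $ i)" for i
    using t(2)[of i] by (simp add: xy)
  obtain i0 where i0: "max 0 (q $ i0) < - p $ i0" using basis_exceeds[OF b p q] by blast
  obtain i1 where i1: "max 0 (p $ i1) < - q $ i1"
    using basis_exceeds[OF basis_commute[OF b] q p] by blast
  obtain i2 where i2: "max 0 (p $ i2) < p $ i2 + q $ i2"
    using exceeds[OF p PL P] by auto
  obtain i3 where i3: "max 0 (q $ i3) < p $ i3 + q $ i3"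
    using exceeds[OF q PL P] by auto
  have n: "\<not> (x = 0 \<and> 0 < y)" "\<not> (y = 0 \<and> 0 < x)" "\<not> (x = 0 \<and> y = 0)"
    using neg_multiple[OF p basis_nonzero(1)[OF b], of x] neg_multiple[OF q basis_nonzero(2)[OF b], of y]
      nt(1) ne(1) by (auto simp: xy)
  consider "1 \<le> x" "1 \<le> y" | "1 \<le> x" "y \<le> -1" | "x \<le> -1" "1 \<le> y" | "x \<le> 0" "y \<le> 0"
    using n by linarith
  then show ?thesis
  proof cases
    case 1
    have "\<not> (x = 1 \<and> 1 < y)"
      using neg_multiple[OF q basis_nonzero(2)[OF b], of "y - 1"] nt(2)
      by (auto simp: xy vec_eq_iff algebra_simps elim: back_subst[of "\<lambda>v. v \<in> D"])
    moreover have "\<not> (y = 1 \<and> 1 < x)"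
      using neg_multiple[OF p basis_nonzero(1)[OF b], of "x - 1"] nt(2)
      by (auto simp: xy vec_eq_iff algebra_simps elim: back_subst[of "\<lambda>v. v \<in> D"])
    ultimately have "1 < x" "1 < y" using 1 ne(2) by (auto simp: xy)
    have "(y - 1) * q $ i2 \<le> (x - 1) * (- p $ i2)"
      using tle[of i2] i2 by (auto simp: algebra_simps)
    moreover have "(x - 1) * (- p $ i2) < (x - 1) * q $ i2"
      using i2 \<open>1 < x\<close> by (intro mult_strict_left_mono) auto
    ultimately have "(y - 1) * q $ i2 < (x - 1) * q $ i2" by linarith
    then have "y < x" using i2 by (simp add: mult_less_cancel_right)
    have "(x - 1) * p $ i3 \<le> (y - 1) * (- q $ i3)"
      using tle[of i3] i3 by (auto simp: algebra_simps)
    moreover have "(y - 1) * (- q $ i3) < (y - 1) * p $ i3"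
      using i3 \<open>1 < y\<close> by (intro mult_strict_left_mono) auto
    ultimately have "(x - 1) * p $ i3 < (y - 1) * p $ i3" by linarith
    then have "x < y" using i3 by (simp add: mult_less_cancel_right)
    with \<open>y < x\<close> show ?thesis by simp
  next
    case 2
    have "p $ i < 0" if "q $ i < 0" for i
    proof (rule ccontr)
      assume "\<not> p $ i < 0"
      then have "1 * p $ i \<le> x * p $ i" using 2 by (intro mult_right_mono) auto
      moreover have "-1 * q $ i \<le> y * q $ i" using 2 that by (intro mult_right_mono_neg) auto
      ultimately show False using tle[of i] that \<open>\<not> p $ i < 0\<close> by simp
    qed
    then show ?thesis by blast
  next
    case 3
    have "q $ i < 0" if "p $ i < 0" for i
    proof (rule ccontr)
      assume "\<not> q $ i < 0"
      then have "1 * q $ i \<le> y * q $ i" using 3 by (intro mult_right_mono) auto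
      moreover have "-1 * p $ i \<le> x * p $ i" using 3 that by (intro mult_right_mono_neg) auto
      ultimately show False using tle[of i] that \<open>\<not> q $ i < 0\<close> by simp
    qed
    then show ?thesis by blast
  next
    case 4
    have "(- x) * (- p $ i0) \<le> (- y) * q $ i0" using tle[of i0] i0 by auto
    then have "- x < - y \<or> x = 0 \<and> (y = 0 \<or> 0 \<le> q $ i0)"
      using le_of_comb_le[of "q $ i0" "- p $ i0" "- x" "- y"] 4 i0 by auto
    moreover have "(- y) * (- q $ i1) \<le> (- x) * p $ i1" using tle[of i1] i1 by auto
    then have "- y < - x \<or> y = 0 \<and> (x = 0 \<or> 0 \<le> p $ i1)"
      using le_of_comb_le[of "p $ i1" "- q $ i1" "- y" "- x"] 4 i1 by auto
    ultimately show ?thesis using n by auto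
  qed
qed

text \<open>Euclidean descent on (a, c). If p + q is in D, the vector belongs to one of the two
  cones cut out by p + q, with smaller coefficients. If not, the nested supports from
  \<open>gap\<close> make -p or -q lie in D by \<open>D_down\<close>.\<close>

lemma neg_cone:
  assumes "basis p q" "p \<in> D" "q \<in> D" "0 \<le> a" "0 \<le> c" "- (a *s p + c *s q) \<in> D"
  shows "a = 0 \<and> c = 0"
  using assms
proof (induction "nat (a + c)" arbitrary: p q a c rule: less_induct)
  case less
  note b = less.prems(1) and p = less.prems(2) and q = less.prems(3) and m = less.prems(6)
  show ?case
  proof (rule ccontr)
    assume "\<not> (a = 0 \<and> c = 0)"
    with neg_multiple[OF p basis_nonzero(1)[OF b], of a] neg_multiple[OF q basis_nonzero(2)[OF b], of c]
      less.prems(4,5) m have ac: "1 \<le> a" "1 \<le> c"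
      by (cases "a = 0"; cases "c = 0"; force)+
    show False
    proof (cases "p + q \<in> D")
      case True
      consider "a = c" | "c < a" | "a < c" by linarith
      then show False
      proof cases
        case 1
        then show False
          using neg_multiple[OF True basis_nonzero(2)[OF basis_add1[OF b]] ac(1)] m
          by (simp add: vector_add_ldistrib)
      next
        case 2
        have "(a - c) *s p + c *s (p + q) = a *s p + c *s q" by (simp add: vec_eq_iff algebra_simps)
        then show False
          using less.hyps[of "a - c" c p "p + q"] basis_add1[OF b] p True 2 ac m by auto
      next
        case 3
        have "a *s (p + q) + (c - a) *s q = a *s p + c *s q" by (simp add: vec_eq_iff algebra_simps)
        then show False
          using less.hyps[of a "c - a" "p + q" q] basis_add2[OF b] q True 3 ac m by auto
      qed
    next
      case False
      have *: False if "- r \<in> D" "r \<in> D" "r \<noteq> 0" for r using that D_antisym by blast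
      from gap[OF b p q False] show False
      proof
        assume h: "\<forall>i. q $ i < 0 \<longrightarrow> p $ i < 0"
        have "- q \<in> D" using neg_le_neg_comb[OF _ ac(2) less.prems(4)] h
          by (intro D_down[OF m uminus_L[OF D_L[OF q]]]) (auto simp: add.commute)
        with * q basis_nonzero[OF b] show False by blast
      next
        assume h: "\<forall>i. p $ i < 0 \<longrightarrow> q $ i < 0"
        have "- p \<in> D" using neg_le_neg_comb[OF _ ac(1) less.prems(5)] h
          by (intro D_down[OF m uminus_L[OF D_L[OF p]]]) auto
        with * p basis_nonzero[OF b] show False by blast
      qed
    qed
  qed
qed

section \<open>Enlarging a basis until the negative supports are disjoint\<close>

lemma no_mixed_choice:
  assumes b: "basis p q" and p: "p \<in> D" and q: "q \<in> D"
    and t: "t = a *s p + c *s q" "\<And>i. t $ i \<le> max (p $ i) (q $ i)"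
    and nt: "p - t \<in> D" "q - t \<in> D" and ac: "0 < a" "c < 0"
  shows False
proof -
  have tL: "t \<in> L" using t(1) b by (auto simp: basis_def add_L smult_L)
  have tle: "a * p $ i + c * q $ i \<le> max (p $ i) (q $ i)" for i
    using t(2)[of i] by (simp add: t(1))
  show False
  \<comment> \<open>The alternative is a \<le> - c. In the first case t - p, in the second t - q
    lies in D together with its negative.\<close>
  proof (cases "- c \<le> a - 1")
    case True
    have "t - p \<in> D"
      using mixed_bound1[OF ac(2) True tle]
      by (intro D_down[OF q diff_L[OF tL D_L[OF p]]]) (auto simp: t(1) algebra_simps)
    then have "t - p = 0" using nt(1) D_antisym[of "t - p"] by simp
    then have "(a - 1) *s p + c *s q = 0" by (simp add: t(1) vec_eq_iff algebra_simps)
    with basis_zero[OF b] ac show False by blast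
  next
    case False
    have "t - q \<in> D"
      using mixed_bound2[OF ac(1) _ tle] False
      by (intro D_down[OF p diff_L[OF tL D_L[OF q]]]) (auto simp: t(1) algebra_simps)
    then have "t - q = 0" using nt(2) D_antisym[of "t - q"] by simp
    then have "a *s p + (c - 1) *s q = 0" by (simp add: t(1) vec_eq_iff algebra_simps)
    with basis_zero[OF b] ac show False by blast
  qed
qed

text \<open>The standard point t of the box max(p, q) must be p or q, and the difference from the
  other vector is then in D. The common negative coordinate excludes a, c \<le> 0: there t would be
  nonnegative while the box is negative.\<close>

lemma extend:
  assumes b: "basis p q" and p: "p \<in> D" and q: "q \<in> D" and i: "p $ i < 0" "q $ i < 0"
  shows "q - p \<in> D \<or> p - q \<in> D"
proof -
  note pL = D_L[OF p] and qL = D_L[OF q]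
  obtain t where t: "t \<in> L" "\<And>i. t $ i \<le> max (p $ i) (q $ i)"
    and T: "\<And>y. y \<in> L \<Longrightarrow> (\<And>i. y $ i \<le> max (p $ i) (q $ i)) \<Longrightarrow> y - t \<in> D"
    using choice2[OF pL, of q] by blast
  have nt: "p - t \<in> D" "q - t \<in> D" using T[of p] T[of q] pL qL by auto
  obtain a c where ac: "t = a *s p + c *s q" using basis_coords[OF b t(1)] .
  have tle: "a * p $ i + c * q $ i \<le> max (p $ i) (q $ i)"
    using t(2)[of i] by (simp add: ac)
  consider "1 \<le> a" "0 \<le> c" | "0 \<le> a" "1 \<le> c" | "a \<le> 0" "c \<le> 0" | "0 < a" "c < 0" | "a < 0" "0 < c"
    by linarith
  then show ?thesis
  proof cases
    case 1
    have "p - t = - ((a - 1) *s p + c *s q)" by (simp add: ac vec_eq_iff algebra_simps)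
    with nt(1) have "a - 1 = 0 \<and> c = 0" using 1 by (intro neg_cone[OF b p q]) simp_all
    then have "t = p" by (simp add: ac)
    with nt show ?thesis by simp
  next
    case 2
    have "q - t = - (a *s p + (c - 1) *s q)" by (simp add: ac vec_eq_iff algebra_simps)
    with nt(2) have "a = 0 \<and> c - 1 = 0" using 2 by (intro neg_cone[OF b p q]) simp_all
    then have "t = q" by (simp add: ac)
    with nt show ?thesis by simp
  next
    case 3
    then have "0 \<le> a * p $ i" "0 \<le> c * q $ i" using i by (auto simp: zero_le_mult_iff)
    with tle i show ?thesis by linarith
  next
    case 4
    with no_mixed_choice[OF b p q ac t(2) nt] show ?thesis by blast
  next
    case 5
    have "t = c *s q + a *s p" by (simp add: ac)
    with no_mixed_choice[OF basis_commute[OF b] q p _ _ nt(2,1)] t(2) 5 show ?thesis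
      by (metis max.commute)
  qed
qed

text \<open>Termination measure. Replacing q by q - p creates no new common negative coordinate, and
  where one survives its weight drops from |p_i| + |q_i| to |q_i|.\<close>

definition overlap :: "int^'n \<Rightarrow> int^'n \<Rightarrow> nat" where
  "overlap p q = (\<Sum>i\<in>UNIV. if p $ i < 0 \<and> q $ i < 0 then nat (- p $ i - q $ i) else 0)"

lemma overlap_commute: "overlap p q = overlap q p"
  unfolding overlap_def by (intro sum.cong) (auto simp: algebra_simps)

lemma overlap_diff:
  assumes "p $ i < 0" "q $ i < 0"
  shows "overlap p (q - p) < overlap p q"
  unfolding overlap_def
  by (rule sum_strict_mono_ex1) (use assms in auto)

lemma ex_disjoint_basis:
  assumes "basis p q" "p \<in> D" "q \<in> D"
  shows "\<exists>p q. basis p q \<and> p \<in> D \<and> q \<in> D \<and> (\<forall>i. \<not> (p $ i < 0 \<and> q $ i < 0))"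
  using assms
proof (induction "overlap p q" arbitrary: p q rule: less_induct)
  case less
  show ?case
  proof (cases "\<exists>i. p $ i < 0 \<and> q $ i < 0")
    case True
    then obtain i where i: "p $ i < 0" "q $ i < 0" by blast
    from extend[OF less.prems i] show ?thesis
    proof
      assume "q - p \<in> D"
      with less.hyps[OF overlap_diff[of p i q]] i less.prems basis_diff show ?thesis by blast
    next
      assume "p - q \<in> D"
      moreover have "overlap q (p - q) < overlap p q"
        using overlap_diff[of q i p] i overlap_commute by simp
      ultimately show ?thesis
        using less.hyps[of q "p - q"] less.prems basis_diff[OF basis_commute] by blast
    qed
  qed (use less.prems in blast)
qed

text \<open>If a < 0 and c is nonnegative, c q is nonnegative wherever p is negative, so
  \<open>D_down\<close> would put -p into D. If both are negative, the vector lies in the opposite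
  cone.\<close>

lemma disjoint_coords_nonneg:
  assumes b: "basis p q" and p: "p \<in> D" and q: "q \<in> D"
    and disj: "\<And>i. \<not> (p $ i < 0 \<and> q $ i < 0)" and z: "a *s p + c *s q \<in> D"
  shows "0 \<le> a"
proof (rule ccontr)
  assume a: "\<not> 0 \<le> a"
  show False
  proof (cases "0 \<le> c")
    case True
    have "- p $ i \<le> max 0 (a * p $ i + c * q $ i)" for i
    proof (cases "p $ i < 0")
      case True
      then have "-1 * p $ i \<le> a * p $ i" using a by (intro mult_right_mono_neg) auto
      moreover have "0 \<le> c * q $ i" using disj[of i] True \<open>0 \<le> c\<close> by auto
      ultimately show ?thesis by simp
    qed simp
    then have "- p \<in> D" using D_down[OF z uminus_L[OF D_L[OF p]]] by simp
    with D_antisym[OF p] basis_nonzero[OF b] show False by blast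
  next
    case False
    have "a *s p + c *s q = - ((- a) *s p + (- c) *s q)" by (simp add: vec_eq_iff)
    with z have "- ((- a) *s p + (- c) *s q) \<in> D" by (simp only:)
    with neg_cone[OF b p q, of "- a" "- c"] a False show False by simp
  qed
qed

section \<open>Vectors in the interior of the cone\<close>

text \<open>This makes the monomial with exponent max(0, q, p + q) standard. If t were nonzero, it
  would exceed 0 and p + q at some j, where q is then the strict maximum and p is negative. Opposite
  signs of a and c fail at j, nonpositive ones at i0 and i1.\<close>

lemma choice_at_zero:
  assumes b: "basis p q" and p: "p \<in> D" and q: "q \<in> D" and P: "p + q \<in> D"
    and t: "t \<in> L" "\<And>i. t $ i \<le> max (max 0 (q $ i)) ((p + q) $ i)"
    and nt: "- t \<in> D"
  shows "t = 0"
proof (rule ccontr)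
  assume ne: "t \<noteq> 0"
  then have "t \<notin> D" using nt D_antisym[of t] by blast
  obtain a c where ac: "t = a *s p + c *s q" using basis_coords[OF b t(1)] .
  have tle: "a * p $ i + c * q $ i \<le> max (max 0 (q $ i)) (p $ i + q $ i)" for i
    using t(2)[of i] by (simp add: ac)
  obtain i0 where i0: "max 0 (q $ i0) < - p $ i0" using basis_exceeds[OF b p q] by blast
  obtain i1 where i1: "max 0 (p $ i1) < - q $ i1"
    using basis_exceeds[OF basis_commute[OF b] q p] by blast
  obtain j where j: "max 0 (p $ j + q $ j) < a * p $ j + c * q $ j"
    using exceeds[OF P t(1) \<open>t \<notin> D\<close>] by (auto simp: ac)
  with tle[of j] have tq: "a * p $ j + c * q $ j \<le> q $ j" "p $ j < 0" "0 < q $ j" by auto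
  consider "0 \<le> a" "0 \<le> c" | "0 < a" "c < 0" | "a < 0" "0 < c" | "a \<le> 0" "c \<le> 0"
    by linarith
  then show False
  proof cases
    case 1
    with neg_cone[OF b p q, of a c] nt ne show False by (auto simp: ac)
  next
    case 2
    then have "a * p $ j < 0" "c * q $ j < 0" using tq by (auto simp: mult_less_0_iff)
    with j show False by simp
  next
    case 3
    then have "0 < a * p $ j" using tq by (auto simp: zero_less_mult_iff)
    moreover have "1 * q $ j \<le> c * q $ j" using 3 tq by (intro mult_right_mono) auto
    ultimately show False using tq by simp
  next
    case 4
    have "(- c) * (- q $ i1) \<le> (- a) * p $ i1" using tle[of i1] i1 by auto
    then have 1: "- c < - a \<or> c = 0 \<and> a = 0"
      using le_of_comb_le[of "p $ i1" "- q $ i1" "- c" "- a"] 4 i1 ne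
      by (auto simp: ac)
    \<comment> \<open>The box allows an extra max(0, q) here, absorbed by replacing -c with 1 - c.
      By integrality -a \<le> -c (or a = 0) remains, which still clashes with fact
      \<open>1\<close>.\<close>
    have "(- a) * (- p $ i0) \<le> (- c) * q $ i0 + max 0 (q $ i0)" using tle[of i0] i0 by auto
    moreover have "(- c) * q $ i0 \<le> 0" if "q $ i0 \<le> 0"
      using that 4 by (auto simp: zero_le_mult_iff)
    ultimately have "(- a) * (- p $ i0) \<le> (1 - c) * max 0 (q $ i0)"
      by (auto simp: max_def algebra_simps)
    then have "- a < 1 - c \<or> a = 0"
      using le_of_comb_le[of "max 0 (q $ i0)" "- p $ i0" "- a" "1 - c"] 4 i0 by auto
    moreover have "t = 0" if "a = 0" "c = 0" using that by (simp add: ac)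
    ultimately show False using 1 4 ne by auto
  qed
qed

text \<open>The descent of \<open>neg_cone\<close> again. It ends at a = c, where minimality of the
  negative part of g gives g = p + q. If p + q is not in D, \<open>gap\<close> and minimality force
  g = p or g = q, contrary to both coefficients being positive.\<close>

lemma decompose:
  assumes "basis p q" "p \<in> D" "q \<in> D" "1 \<le> a" "1 \<le> c" "g = a *s p + c *s q" "g \<in> D"
    and min: "\<And>h. h \<in> D \<Longrightarrow> h \<noteq> 0 \<Longrightarrow> (\<And>i. max 0 (- h $ i) \<le> max 0 (- g $ i)) \<Longrightarrow> h = g"
  shows "\<exists>m m'. basis m m' \<and> m \<in> D \<and> m' \<in> D \<and> g = m + m'"
  using assms(1-6)
proof (induction "nat (a + c)" arbitrary: p q a c rule: less_induct)
  case less
  note b = less.prems(1) and p = less.prems(2) and q = less.prems(3)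
    and ac = less.prems(4,5) and g = less.prems(6)
  show ?case
  proof (cases "p + q \<in> D")
    case True
    consider "a = c" | "c < a" | "a < c" by linarith
    then show ?thesis
    proof cases
      case 1
      have "- (p $ i + q $ i) \<le> max 0 (- (a * (p $ i + q $ i)))" for i
        using neg_le_neg_comb[of "p $ i + q $ i" "p $ i + q $ i" a 0] ac by simp
      then have "p + q = g"
        using True basis_nonzero(2)[OF basis_add1[OF b]] 1
        by (intro min) (auto simp: g algebra_simps)
      then show ?thesis using b p q by blast
    next
      case 2
      have "g = (a - c) *s p + c *s (p + q)" by (simp add: g vec_eq_iff algebra_simps)
      then show ?thesis
        using less.hyps[of "a - c" c p "p + q"] basis_add1[OF b] p True 2 ac by auto
    next
      case 3
      have "g = a *s (p + q) + (c - a) *s q" by (simp add: g vec_eq_iff algebra_simps)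
      then show ?thesis
        using less.hyps[of a "c - a" "p + q" q] basis_add2[OF b] q True 3 ac by auto
    qed
  next
    case False
    have nn: "0 \<le> a" "0 \<le> c" using ac by auto
    from gap[OF b p q False] show ?thesis
    proof
      assume h: "\<forall>i. q $ i < 0 \<longrightarrow> p $ i < 0"
      have "q = g" using neg_le_neg_comb[OF _ ac(2) nn(1)] h q basis_nonzero[OF b]
        by (intro min) (auto simp: g add.commute)
      then have "0 = a *s p + (c - 1) *s q" by (simp add: g vec_eq_iff algebra_simps)
      with basis_zero[OF b, of a "c - 1"] ac show ?thesis by simp
    next
      assume h: "\<forall>i. p $ i < 0 \<longrightarrow> q $ i < 0"
      have "p = g" using neg_le_neg_comb[OF _ ac(1) nn(2)] h p basis_nonzero[OF b]
        by (intro min) (auto simp: g)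
      then have "0 = (a - 1) *s p + c *s q" by (simp add: g vec_eq_iff algebra_simps)
      with basis_zero[OF b, of "a - 1" c] ac show ?thesis by simp
    qed
  qed
qed

section \<open>Existence of a basis inside D\<close>

lemma basis_of_det_1:
  assumes b: "basis e f" and u: "u = u1 *s e + u2 *s f" and v: "v = v1 *s e + v2 *s f"
    and det: "u1 * v2 - u2 * v1 = 1"
  shows "basis u v"
  unfolding basis_def
proof (intro conjI ballI allI impI)
  show "u \<in> L" "v \<in> L" using b by (auto simp: u v basis_def add_L smult_L)
  fix z assume "z \<in> L"
  then obtain x y where z: "z = x *s e + y *s f" using basis_coords[OF b] by blast
  \<comment> \<open>Cramer's rule, with integral solution because the determinant is 1.\<close>
  have "x * (u1 * v2 - u2 * v1) = (x * v2 - y * v1) * u1 + (u1 * y - u2 * x) * v1"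
    "y * (u1 * v2 - u2 * v1) = (x * v2 - y * v1) * u2 + (u1 * y - u2 * x) * v2"
    by algebra+
  then obtain a c where "x = a * u1 + c * v1" "y = a * u2 + c * v2"
    unfolding det mult_1_right by blast
  then have "z = a *s u + c *s v" unfolding z u v by (simp add: vec_eq_iff algebra_simps)
  then show "\<exists>a c. z = a *s u + c *s v" by blast
next
  fix a c assume "a *s u + c *s v = 0"
  moreover have "a *s u + c *s v = (a * u1 + c * v1) *s e + (a * u2 + c * v2) *s f"
    unfolding u v by (simp add: vec_eq_iff algebra_simps)
  ultimately have 0: "a * u1 + c * v1 = 0" "a * u2 + c * v2 = 0" using basis_zero[OF b] by auto
  have "a * (u1 * v2 - u2 * v1) = (a * u1 + c * v1) * v2 - (a * u2 + c * v2) * v1"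
    "c * (u1 * v2 - u2 * v1) = (a * u2 + c * v2) * u1 - (a * u1 + c * v1) * u2"
    by algebra+
  then show "a = 0" "c = 0" unfolding det 0 by simp_all
qed

text \<open>A lattice triangle contains a unimodular one: a pair of smallest nonzero determinant is a basis,
  since otherwise some lattice point of the parallelogram, or its mirror image, lies in the triangle.\<close>

lemma basis_in_triangle_closed:
  assumes b: "basis e f"
    and closed: "\<And>u v h d i j. u \<in> A \<Longrightarrow> v \<in> A \<Longrightarrow> h \<in> L \<Longrightarrow> 0 < d \<Longrightarrow> 0 \<le> i \<Longrightarrow> 0 \<le> j \<Longrightarrow>
      i + j \<le> d \<Longrightarrow> d *s h = i *s u + j *s v \<Longrightarrow> h \<in> A"
    and uv: "u1 *s e + u2 *s f \<in> A" "v1 *s e + v2 *s f \<in> A" "u1 * v2 - u2 * v1 \<noteq> (0::int)"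
  shows "\<exists>u\<in>A. \<exists>v\<in>A. basis u v"
  using uv
proof (induction "nat \<bar>u1 * v2 - u2 * v1\<bar>" arbitrary: u1 u2 v1 v2 rule: less_induct)
  case less
  \<comment> \<open>Proved for arbitrary vectors of positive determinant, so that the negative case
    follows by exchanging u and v.\<close>
  have pos: ?case if hyp: "\<And>u1' u2' v1' v2'. \<lbrakk>nat \<bar>u1' * v2' - u2' * v1'\<bar> < nat \<bar>u1 * v2 - u2 * v1\<bar>;
        u1' *s e + u2' *s f \<in> A; v1' *s e + v2' *s f \<in> A; u1' * v2' - u2' * v1' \<noteq> 0\<rbrakk>
       \<Longrightarrow> \<exists>u\<in>A. \<exists>v\<in>A. basis u v"
      and u: "u1 *s e + u2 *s f \<in> A" and v: "v1 *s e + v2 *s f \<in> A"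
      and d0: "0 < u1 * v2 - u2 * v1" for u1 u2 v1 v2
  proof (cases "u1 * v2 - u2 * v1 = 1")
    case True
    from basis_of_det_1[OF b refl refl this] u v show ?thesis by blast
  next
    case False
    define d where "d = u1 * v2 - u2 * v1"
    have d: "2 \<le> d" using d0 False by (simp add: d_def)
    \<comment> \<open>Otherwise d * d would divide the determinant d. Hence for one of the two unit
      vectors k the Cramer numerators are not both divisible by d.\<close>
    have "\<not> (d dvd u1 \<and> d dvd u2 \<and> d dvd v1 \<and> d dvd v2)"
    proof
      assume "d dvd u1 \<and> d dvd u2 \<and> d dvd v1 \<and> d dvd v2"
      then have "d * d dvd u1 * v2 - u2 * v1" by (intro dvd_diff mult_dvd_mono) auto
      then have "d * d dvd d * 1" by (simp add: d_def)
      then have "d dvd 1" using d by (subst (asm) dvd_mult_cancel_left) auto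
      with d show False by simp
    qed
    then have "\<exists>k1 k2. \<not> (d dvd k1 * v2 - k2 * v1 \<and> d dvd u1 * k2 - u2 * k1)"
      by (metis diff_0 diff_zero dvd_minus_iff mult_1 mult_1_right mult_zero_left mult_zero_right)
    then obtain k1 k2 where k: "\<not> (d dvd k1 * v2 - k2 * v1 \<and> d dvd u1 * k2 - u2 * k1)" by blast
    \<comment> \<open>i/d and j/d are the fractional parts of the coordinates of k with respect to
      u, v; h is k translated into the half-open parallelogram.\<close>
    define i where "i = (k1 * v2 - k2 * v1) mod d"
    define j where "j = (u1 * k2 - u2 * k1) mod d"
    have ij: "0 \<le> i" "i < d" "0 \<le> j" "j < d" "i \<noteq> 0 \<or> j \<noteq> 0"
      using d k by (auto simp: i_def j_def dvd_eq_mod_eq_0)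
    define h1 where "h1 = k1 - ((k1 * v2 - k2 * v1) div d) * u1 - ((u1 * k2 - u2 * k1) div d) * v1"
    define h2 where "h2 = k2 - ((k1 * v2 - k2 * v1) div d) * u2 - ((u1 * k2 - u2 * k1) div d) * v2"
    have h: "d * h1 = i * u1 + j * v1" "d * h2 = i * u2 + j * v2"
    proof -
      have m: "i = (k1 * v2 - k2 * v1) - d * ((k1 * v2 - k2 * v1) div d)"
        "j = (u1 * k2 - u2 * k1) - d * ((u1 * k2 - u2 * k1) div d)"
        by (simp_all add: i_def j_def minus_mult_div_eq_mod)
      have "d * k1 = (k1 * v2 - k2 * v1) * u1 + (u1 * k2 - u2 * k1) * v1"
        "d * k2 = (k1 * v2 - k2 * v1) * u2 + (u1 * k2 - u2 * k1) * v2"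
        unfolding d_def by algebra+
      then show "d * h1 = i * u1 + j * v1" "d * h2 = i * u2 + j * v2"
        unfolding m h1_def h2_def by algebra+
    qed
    have "\<exists>i j h1 h2. 0 \<le> i \<and> i < d \<and> 0 \<le> j \<and> j < d \<and> (i \<noteq> 0 \<or> j \<noteq> 0) \<and> i + j \<le> d \<and>
        d * h1 = i * u1 + j * v1 \<and> d * h2 = i * u2 + j * v2"
    proof (cases "i + j \<le> d")
      case True
      then show ?thesis using ij h by blast
    next
      case False
      have "d * (u1 + v1 - h1) = (d - i) * u1 + (d - j) * v1"
        "d * (u2 + v2 - h2) = (d - i) * u2 + (d - j) * v2" using h by algebra+
      moreover have "0 \<le> d - i \<and> d - i < d \<and> 0 \<le> d - j \<and> d - j < d \<and> (d - i \<noteq> 0 \<or> d - j \<noteq> 0) \<and>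
          (d - i) + (d - j) \<le> d" using ij False by auto
      ultimately show ?thesis by blast
    qed
    then obtain i j h1 h2 where ij: "0 \<le> i" "i < d" "0 \<le> j" "j < d" "i \<noteq> 0 \<or> j \<noteq> 0" "i + j \<le> d"
      and h: "d * h1 = i * u1 + j * v1" "d * h2 = i * u2 + j * v2" by blast
    have "d *s (h1 *s e + h2 *s f) = (d * h1) *s e + (d * h2) *s f"
      by (simp add: vec_eq_iff algebra_simps)
    also have "\<dots> = i *s (u1 *s e + u2 *s f) + j *s (v1 *s e + v2 *s f)"
      unfolding h by (simp add: vec_eq_iff algebra_simps)
    finally have hA: "h1 *s e + h2 *s f \<in> A"
      using b d ij by (intro closed[OF u v]) (auto simp: basis_def add_L smult_L)
    have "d * (h1 * v2 - h2 * v1) = (d * h1) * v2 - (d * h2) * v1"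
      "d * (u1 * h2 - u2 * h1) = u1 * (d * h2) - u2 * (d * h1)" by algebra+
    moreover have "(i * u1 + j * v1) * v2 - (i * u2 + j * v2) * v1 = d * i"
      "u1 * (i * u2 + j * v2) - u2 * (i * u1 + j * v1) = d * j" unfolding d_def by algebra+
    ultimately have "d * (h1 * v2 - h2 * v1) = d * i" "d * (u1 * h2 - u2 * h1) = d * j"
      unfolding h by (simp_all only:)
    \<comment> \<open>The pairs (h, v) and (u, h) have determinants i and j, both below d and not
      both zero, so one of them continues the descent.\<close>
    then have dets: "h1 * v2 - h2 * v1 = i" "u1 * h2 - u2 * h1 = j" using d by simp_all
    show ?thesis
    proof (cases "i = 0")
      case True
      then show ?thesis using hyp[of u1 h2 u2 h1] u hA dets ij d by (simp add: d_def)
    next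
      case False
      then show ?thesis using hyp[of h1 v2 h2 v1] v hA dets ij d by (simp add: d_def)
    qed
  qed
  show ?case
  proof (cases "0 < u1 * v2 - u2 * v1")
    case True
    show ?thesis by (rule pos[OF less.hyps less.prems(1,2) True])
  next
    case False
    then have d: "0 < v1 * u2 - v2 * u1" using less.prems(3) by (simp add: algebra_simps)
    have eq: "\<bar>v1 * u2 - v2 * u1\<bar> = \<bar>u1 * v2 - u2 * v1\<bar>" by (simp add: algebra_simps abs_minus_commute)
    show ?thesis by (rule pos[OF less.hyps less.prems(2,1) d, unfolded eq])
  qed
qed

text \<open>The box around the triangle 0, e, f is translated so that its standard point t becomes
  the origin. The result A lies in D, and convexity of the box gives the closure required by
  \<open>basis_in_triangle_closed\<close>.\<close>

lemma ex_basis_in_D: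
  assumes b: "basis e f"
  shows "\<exists>p q. basis p q \<and> p \<in> D \<and> q \<in> D"
proof -
  let ?w = "\<lambda>i. max (max (0 $ i) (e $ i)) (f $ i)"
  note eL = basis_L(1)[OF b] and fL = basis_L(2)[OF b]
  obtain t where t: "t \<in> L" "\<And>i. t $ i \<le> ?w i"
    and T: "\<And>y. y \<in> L \<Longrightarrow> (\<And>i. y $ i \<le> ?w i) \<Longrightarrow> y - t \<in> D"
    using choice3[OF zero_L, of e f] by blast
  define A where "A = {u \<in> L. \<forall>i. (u + t) $ i \<le> ?w i}"
  have AD: "u \<in> D" if "u \<in> A" for u
    using T[of "u + t"] that t(1) by (auto simp: A_def add_L)
  have A: "y - t \<in> A" if "y \<in> L" "\<And>i. y $ i \<le> ?w i" for y
    using that t(1) by (auto simp: A_def diff_L)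
  have closed: "h \<in> A" if uv: "u \<in> A" "v \<in> A" "h \<in> L" and d: "0 < d" "0 \<le> i" "0 \<le> j" "i + j \<le> d"
    and h: "d *s h = i *s u + j *s v" for u v h d i j
  proof -
    have "h $ k + t $ k \<le> ?w k" for k
    proof -
      have "d * h $ k = i * u $ k + j * v $ k" using h by (simp add: vec_eq_iff)
      then have "d * (h $ k + t $ k) = i * (u $ k + t $ k) + j * (v $ k + t $ k) + (d - i - j) * t $ k"
        by (simp add: algebra_simps)
      also have "\<dots> \<le> i * ?w k + j * ?w k + (d - i - j) * ?w k"
        using uv d t(2)[of k] by (intro add_mono mult_left_mono) (auto simp: A_def)
      also have "\<dots> = d * ?w k" by (simp add: algebra_simps)
      finally show ?thesis using d by (simp add: mult_le_cancel_left_pos)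
    qed
    with uv show ?thesis by (simp add: A_def)
  qed
  obtain a c where ac: "t = a *s e + c *s f" using basis_coords[OF b t(1)] .
  have t0: "(- a) *s e + (- c) *s f \<in> A" and te: "(1 - a) *s e + (- c) *s f \<in> A"
    and tf: "(- a) *s e + (1 - c) *s f \<in> A"
    using A[of 0] A[of e] A[of f] zero_L eL fL
    by (auto simp: ac vec_eq_iff algebra_simps elim!: back_subst[of "\<lambda>v. v \<in> A"])
  \<comment> \<open>Up to sign these are the barycentric coordinates of t in the triangle; they sum
    to 1, so one is nonzero.\<close>
  have det: "(- a) * (- c) - (- c) * (1 - a) = c" "(- a) * (1 - c) - (- c) * (- a) = - a"
    "(1 - a) * (1 - c) - (- c) * (- a) = 1 - a - c" by (simp_all add: algebra_simps)
  consider "c \<noteq> 0" | "- a \<noteq> 0" | "1 - a - c \<noteq> 0" by linarith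
  then have "\<exists>u\<in>A. \<exists>v\<in>A. basis u v"
  proof cases
    case 1
    show ?thesis
      by (rule basis_in_triangle_closed[OF b _ t0 te]) (erule (7) closed, use 1 det in simp)
  next
    case 2
    show ?thesis
      by (rule basis_in_triangle_closed[OF b _ t0 tf]) (erule (7) closed, use 2 det in simp)
  next
    case 3
    show ?thesis
      by (rule basis_in_triangle_closed[OF b _ te tf]) (erule (7) closed, use 3 det in simp)
  qed
  with AD show ?thesis by blast
qed

end

section \<open>Monomial ideals and term orders\<close>

lemma monomial_ideal_iff:
  fixes M :: "('n::finite, 'k::comm_ring_1) mpoly set"
  assumes "monomial_ideal M"
  shows "f \<in> M \<longleftrightarrow> (\<forall>u\<in>Poly_Mapping.keys f. (monom u :: ('n, 'k) mpoly) \<in> M)"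
proof
  obtain A where M: "M = ideal.span (monom ` A)"
    using assms by (auto simp: monomial_ideal_def)
  let ?T = "{f :: ('n, 'k) mpoly. \<forall>u\<in>Poly_Mapping.keys f. (monom u :: ('n, 'k) mpoly) \<in> M}"
  have "ideal.subspace ?T"
  proof (rule ideal.subspaceI)
    show "f + g \<in> ?T" if "f \<in> ?T" "g \<in> ?T" for f g
      using that keys_add[of f g] by blast
    show "c * f \<in> ?T" if f: "f \<in> ?T" for c f
    proof (rule CollectI, rule ballI)
      fix u assume "u \<in> Poly_Mapping.keys (c * f)"
      then obtain b w where "u = b + w" "w \<in> Poly_Mapping.keys f"
        using keys_mult[of c f] by blast
      moreover have "(monom (b + w) :: ('n, 'k) mpoly) = monom b * monom w"
        by (simp add: monom_def mult_single)
      ultimately show "(monom u :: ('n, 'k) mpoly) \<in> M"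
        using f by (simp add: M ideal.span_scale)
    qed
  qed simp
  moreover have "monom ` A \<subseteq> ?T" by (auto simp: monom_def M intro: ideal.span_base)
  ultimately have "M \<subseteq> ?T" unfolding M by (rule ideal.span_minimal[rotated])
  then show "f \<in> M \<Longrightarrow> \<forall>u\<in>Poly_Mapping.keys f. (monom u :: ('n, 'k) mpoly) \<in> M" by blast
  assume h: "\<forall>u\<in>Poly_Mapping.keys f. (monom u :: ('n, 'k) mpoly) \<in> M"
  have "f = (\<Sum>u\<in>Poly_Mapping.keys f. const (Poly_Mapping.lookup f u) * monom u)"
    by (rule poly_mapping_eqI)
      (simp add: lookup_sum const_def monom_def mult_single lookup_single when_def in_keys_iff)
  also have "\<dots> \<in> M" unfolding M using h
    by (intro ideal.span_sum ideal.span_scale) (simp add: M)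
  finally show "f \<in> M" .
qed

lemma min_gens_iff:
  fixes M :: "('n::finite, 'k::comm_ring_1) mpoly set"
  assumes "monomial_ideal M"
  shows "u \<in> min_gens M \<longleftrightarrow> (monom u :: ('n, 'k) mpoly) \<in> M \<and>
    (\<forall>a. (monom a :: ('n, 'k) mpoly) \<in> M \<longrightarrow> a \<le> u \<longrightarrow> a = u)"
proof -
  let ?A = "min_gens M" and ?mono = "monom :: nat^'n \<Rightarrow> ('n, 'k) mpoly"
  have "is_min_gens M ?A" unfolding min_gens_def by (rule theI'[OF ex1_min_gens[OF assms]])
  then have M: "ideal.span (?mono ` ?A) = M" and min: "\<And>A'. A' \<subset> ?A \<Longrightarrow> ideal.span (?mono ` A') \<noteq> M"
    by (auto simp: is_min_gens_def)
  have mem: "?mono u \<in> M \<longleftrightarrow> (\<exists>a\<in>?A. a \<le> u)" for u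
    using monom_in_span_iff[of u ?A, where ?'k = 'k] by (simp add: M)
  have *: "b = u" if u: "u \<in> ?A" and b: "b \<in> ?A" "b \<le> u" for b u
  proof (rule ccontr)
    assume "b \<noteq> u"
    have "?mono ` ?A \<subseteq> ideal.span (?mono ` (?A - {u}))"
    proof
      fix x assume "x \<in> ?mono ` ?A"
      then obtain a where "a \<in> ?A" "x = ?mono a" by blast
      then show "x \<in> ideal.span (?mono ` (?A - {u}))"
        using b \<open>b \<noteq> u\<close> by (cases "a = u") (auto simp: monom_in_span_iff)
    qed
    then have "ideal.span (?mono ` ?A) \<subseteq> ideal.span (?mono ` (?A - {u}))"
      by (rule ideal.span_minimal) simp
    moreover have "ideal.span (?mono ` (?A - {u})) \<subseteq> ideal.span (?mono ` ?A)"
      by (rule ideal.span_mono) auto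
    ultimately have "ideal.span (?mono ` (?A - {u})) = M" using M by blast
    then show False using min[of "?A - {u}"] u by blast
  qed
  show ?thesis
  proof
    assume u: "u \<in> ?A"
    have "a = u" if a: "?mono a \<in> M" "a \<le> u" for a
    proof -
      obtain b where b: "b \<in> ?A" "b \<le> a" using a(1) unfolding mem by blast
      then have "b = u" using * u order_trans[OF b(2) a(2)] by blast
      with a(2) b(2) show "a = u" by simp
    qed
    moreover have "?mono u \<in> M" unfolding mem using u by blast
    ultimately show "?mono u \<in> M \<and> (\<forall>a. ?mono a \<in> M \<longrightarrow> a \<le> u \<longrightarrow> a = u)" by blast
  next
    assume "?mono u \<in> M \<and> (\<forall>a. ?mono a \<in> M \<longrightarrow> a \<le> u \<longrightarrow> a = u)"
    then obtain a where "a \<in> ?A" "a \<le> u" "\<forall>a. ?mono a \<in> M \<longrightarrow> a \<le> u \<longrightarrow> a = u" using mem by blast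
    moreover have "?mono a \<in> M" using \<open>a \<in> ?A\<close> mem by blast
    ultimately show "u \<in> ?A" by blast
  qed
qed

lemma min_gens_span:
  assumes "monomial_ideal M"
  shows "ideal.span (monom ` min_gens M) = M"
  using theI'[OF ex1_min_gens[OF assms]] unfolding min_gens_def[symmetric] by (simp add: is_min_gens_def)

lemma ex_min_gen_below:
  fixes M :: "('n::finite, 'k::comm_ring_1) mpoly set"
  assumes "monomial_ideal M" "(monom u :: ('n, 'k) mpoly) \<in> M"
  shows "\<exists>a\<in>min_gens M. a \<le> u"
  using assms(2) monom_in_span_iff[of u "min_gens M", where ?'k = 'k] min_gens_span[OF assms(1)] by simp

section \<open>Term orders and sums of coefficients\<close>

text \<open>The witness is the lexicographic order with the i-th variable most significant. Refuting
  flippability needs it, since the defining condition is vacuous when no order makes v smaller than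
  u.\<close>

lemma ex_term_order:
  fixes u v :: "nat^'n::finite"
  assumes i: "v $ i < u $ i"
  shows "\<exists>lt. term_order lt \<and> lt v u"
proof -
  obtain f :: "'n \<Rightarrow> nat" where f: "inj f" using finite_imp_inj_to_nat_seg[of "UNIV :: 'n set"] by auto
  define r where "r j = (if j = i then 0 else Suc (f j))" for j
  have r: "r j = r k \<longleftrightarrow> j = k" for j k using f by (auto simp: r_def inj_def)
  define lt where "lt v u \<longleftrightarrow> (\<exists>j. v $ j < u $ j \<and> (\<forall>k. r k < r j \<longrightarrow> v $ k = u $ k))" for v u :: "nat^'n"
  have total: "lt a b \<or> lt b a" if "a \<noteq> b" for a b
  proof -
    have "\<exists>j. a $ j \<noteq> b $ j" using that by (simp add: vec_eq_iff)
    then obtain j where j: "a $ j \<noteq> b $ j" "\<And>k. a $ k \<noteq> b $ k \<Longrightarrow> r j \<le> r k"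
      using ex_has_least_nat[of "\<lambda>j. a $ j \<noteq> b $ j" _ r] by blast
    then have "\<forall>k. r k < r j \<longrightarrow> a $ k = b $ k" by (meson not_le)
    with j(1) show ?thesis unfolding lt_def by (metis linorder_neqE_nat)
  qed
  have trans: "lt a c" if abc: "lt a b" "lt b c" for a b c
  proof -
    obtain j k where j: "a $ j < b $ j" "\<forall>l. r l < r j \<longrightarrow> a $ l = b $ l"
      and k: "b $ k < c $ k" "\<forall>l. r l < r k \<longrightarrow> b $ l = c $ l"
      using abc unfolding lt_def by blast
    consider "j = k" | "r j < r k" | "r k < r j" using r by (metis linorder_neqE_nat)
    then show ?thesis
    proof cases
      case 1
      then show ?thesis unfolding lt_def using j k by (intro exI[of _ j]) auto
    next
      case 2
      then show ?thesis unfolding lt_def using j k by (intro exI[of _ j]) auto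
    next
      case 3
      then show ?thesis unfolding lt_def using j k by (intro exI[of _ k]) auto
    qed
  qed
  have "term_order lt"
    unfolding term_order_def
  proof (intro conjI allI impI)
    show "irreflp lt" by (auto simp: irreflp_def lt_def)
    show "transp lt" using trans by (auto simp: transp_def)
    show "totalp lt" using total by (auto simp: totalp_on_def)
    show "lt 0 u" if "u \<noteq> 0" for u
      using total[of 0 u] that by (auto simp: lt_def)
    show "lt (u + w) (v + w)" if "lt u v" for u v w
      using that by (auto simp: lt_def)
  qed
  moreover have "lt v u" unfolding lt_def using i by (intro exI[of _ i]) (auto simp: r_def)
  ultimately show ?thesis by blast
qed

text \<open>Adding k copies of v < u respects the order, and totality permits cancellation. This
  places the exponents s - k p with positive k above s.\<close>

lemma term_order_multiple:
  fixes w w0 u v :: "nat^'n::finite"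
  assumes lt: "term_order lt" "lt v u" and eq: "w + k *s v = w0 + k *s u" and "0 < k"
  shows "lt w0 w"
proof -
  have trans: "lt a b \<Longrightarrow> lt b c \<Longrightarrow> lt a c" and irr: "\<not> lt a a" and tot: "a \<noteq> b \<Longrightarrow> lt a b \<or> lt b a"
    and add: "lt a b \<Longrightarrow> lt (a + c) (b + c)" for a b c
    using lt(1) unfolding term_order_def transp_def irreflp_def totalp_on_def by auto
  have mult: "lt (Suc m *s v) (Suc m *s u)" for m
  proof (induction m)
    case 0
    have "Suc 0 *s x = x" for x :: "nat^'n" by (simp add: vec_eq_iff)
    then show ?case using lt(2) by simp
  next
    case (Suc m)
    have S: "Suc (Suc m) *s x = Suc m *s x + x" for x :: "nat^'n" by (simp add: vec_eq_iff)
    have "lt (Suc m *s v + v) (Suc m *s u + v)" using add[OF Suc] .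
    moreover have "lt (Suc m *s u + v) (Suc m *s u + u)"
      using add[OF lt(2), of "Suc m *s u"] by (simp add: add.commute)
    ultimately show ?case unfolding S by (rule trans)
  qed
  obtain m where k: "k = Suc m" using \<open>0 < k\<close> gr0_conv_Suc by blast
  show ?thesis
  proof (rule ccontr)
    assume "\<not> lt w0 w"
    then consider "w = w0" | "lt w w0" using tot by blast
    then show False
    proof cases
      case 1
      with eq have "k *s v = k *s u" by simp
      with mult[of m] irr k show False by simp
    next
      case 2
      have "lt (w + k *s v) (w0 + k *s v)" using add[OF 2] .
      moreover have "lt (w0 + k *s v) (w0 + k *s u)"
        using add[OF mult[of m], of w0] by (simp add: k add.commute)
      ultimately show False using eq trans irr by metis
    qed
  qed
qed

definition coeff_sum :: "(nat^'n \<Rightarrow> bool) \<Rightarrow> ('n::finite, 'k::comm_ring_1) mpoly \<Rightarrow> 'k" where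
  "coeff_sum P f = (\<Sum>w\<in>Poly_Mapping.keys f. Poly_Mapping.lookup f w when P w)"

lemma coeff_sum_superset:
  assumes "finite A" "Poly_Mapping.keys f \<subseteq> A"
  shows "coeff_sum P f = (\<Sum>w\<in>A. Poly_Mapping.lookup f w when P w)"
  unfolding coeff_sum_def using assms by (intro sum.mono_neutral_left) (auto simp: in_keys_iff)

lemma coeff_sum_add: "coeff_sum P (f + g) = coeff_sum P f + coeff_sum P g"
proof -
  let ?A = "Poly_Mapping.keys f \<union> Poly_Mapping.keys g"
  have "coeff_sum P (f + g) = (\<Sum>w\<in>?A. Poly_Mapping.lookup (f + g) w when P w)"
    by (rule coeff_sum_superset) (simp_all add: Poly_Mapping.keys_add)
  also have "\<dots> = (\<Sum>w\<in>?A. Poly_Mapping.lookup f w when P w) + (\<Sum>w\<in>?A. Poly_Mapping.lookup g w when P w)"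
    unfolding sum.distrib[symmetric] by (intro sum.cong) (simp_all add: lookup_add when_def)
  also have "(\<Sum>w\<in>?A. Poly_Mapping.lookup f w when P w) = coeff_sum P f"
    by (rule coeff_sum_superset[symmetric]) simp_all
  also have "(\<Sum>w\<in>?A. Poly_Mapping.lookup g w when P w) = coeff_sum P g"
    by (rule coeff_sum_superset[symmetric]) simp_all
  finally show ?thesis .
qed

lemma coeff_sum_zero [simp]: "coeff_sum P 0 = 0"
  by (simp add: coeff_sum_def)

lemma coeff_sum_diff: "coeff_sum P (f - g) = coeff_sum P f - coeff_sum P g"
  using coeff_sum_add[of P "f - g" g] by simp

lemma coeff_sum_sum: "coeff_sum P (sum F A) = (\<Sum>x\<in>A. coeff_sum P (F x))"
  by (induction A rule: infinite_finite_induct) (auto simp: coeff_sum_add)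

lemma coeff_sum_single: "coeff_sum P (Poly_Mapping.single w c) = (c when P w)"
  by (cases "c = 0") (auto simp: coeff_sum_def)

section \<open>Flips of monomial graded ideals\<close>

definition vint :: "nat^'n::finite \<Rightarrow> int^'n" where
  "vint u = (\<chi> i. int (u $ i))"

definition pos :: "int^'n::finite \<Rightarrow> nat^'n" where
  "pos z = (\<chi> i. nat (z $ i))"

lemma vint_nth [simp]: "vint u $ i = int (u $ i)"
  by (simp add: vint_def)

lemma pos_nth [simp]: "pos z $ i = nat (z $ i)"
  by (simp add: pos_def)

lemma vint_inject [simp]: "vint u = vint v \<longleftrightarrow> u = v"
  by (simp add: vec_eq_iff)

lemma vint_pos_diff: "vint (pos z) - vint (pos (- z)) = z"
  by (simp add: vec_eq_iff)

lemma neg_part_multiple: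
  assumes "1 \<le> k"
  shows "pos (- r) \<le> pos (- (k *s r))"
proof -
  have "nat (- r $ i) \<le> nat (- (k * r $ i))" for i
    using neg_le_neg_comb[of "r $ i" "r $ i" k 0] assms by simp
  then show ?thesis by (simp add: less_eq_vec_def)
qed

locale monomial_graded_ideal =
  fixes L :: "(int^'n::finite) set" and M :: "('n, 'k::field) mpoly set"
  assumes subspace_L: "int_lattice.subspace L"
    and monomial: "monomial_ideal M"
    and graded: "L_graded L M"
begin

abbreviation std :: "nat^'n \<Rightarrow> bool" where
  "std u \<equiv> (monom u :: ('n, 'k) mpoly) \<notin> M"

lemma std_down:
  assumes "std v" "u \<le> v"
  shows "std u"
proof
  assume "(monom u :: ('n, 'k) mpoly) \<in> M"
  then obtain a where a: "a \<in> min_gens M" "a \<le> u" using ex_min_gen_below[OF monomial] by blast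
  have "a \<le> v" using a(2) assms(2) by (rule order_trans)
  with a(1) have "(monom v :: ('n, 'k) mpoly) \<in> ideal.span (monom ` min_gens M)"
    unfolding monom_in_span_iff by blast
  with assms(1) min_gens_span[OF monomial] show False by simp
qed

lemma M_subspace: "ideal.subspace M"
  using min_gens_span[OF monomial] ideal.subspace_span by metis

lemma mem_mdeg: "x \<in> mdeg L u \<longleftrightarrow> x - vint u \<in> L"
proof
  assume "x - vint u \<in> L"
  moreover have "x = vint u + (x - vint u)" by simp
  ultimately show "x \<in> mdeg L u" unfolding mdeg_def elt_set_plus_def vint_def by blast
qed (auto simp: mdeg_def elt_set_plus_def vint_def)

lemma mdeg_eq_iff: "mdeg L u = mdeg L v \<longleftrightarrow> vint v - vint u \<in> L"
proof
  assume "mdeg L u = mdeg L v"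
  moreover have "vint v \<in> mdeg L v" using int_lattice.subspace_0[OF subspace_L] by (simp add: mem_mdeg)
  ultimately show "vint v - vint u \<in> L" using mem_mdeg by blast
next
  assume "vint v - vint u \<in> L"
  then have "x - vint u \<in> L \<longleftrightarrow> x - vint v \<in> L" for x
    using int_lattice.subspace_add[OF subspace_L, of "x - vint v" "vint v - vint u"]
      int_lattice.subspace_diff[OF subspace_L, of "x - vint u" "vint v - vint u"] by auto
  then show "mdeg L u = mdeg L v" using mem_mdeg by blast
qed

lemma graded_piece_basis:
  obtains b where "b \<in> graded_piece L (mdeg L u)" "\<And>c. const c * b \<in> M \<Longrightarrow> c = 0"
    "\<And>f. f \<in> graded_piece L (mdeg L u) \<Longrightarrow> \<exists>c. f - const c * b \<in> M"
proof -
  have "mdeg L u \<in> Gplus L" by (simp add: Gplus_def)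
  then have "dim_mod (graded_piece L (mdeg L u)) M 1" using graded by (simp add: L_graded_def)
  then obtain B where B: "B \<subseteq> graded_piece L (mdeg L u)" "card B = 1"
    and ind: "\<forall>c. (\<Sum>b\<in>B. const (c b) * b) \<in> M \<longrightarrow> (\<forall>b\<in>B. c b = 0)"
    and gen: "\<forall>f\<in>graded_piece L (mdeg L u). \<exists>c. f - (\<Sum>b\<in>B. const (c b) * b) \<in> M"
    unfolding dim_mod_def by blast
  obtain b where b: "B = {b}" using B(2) card_1_singletonE by blast
  show thesis
  proof (rule that[of b])
    show "b \<in> graded_piece L (mdeg L u)" using B b by simp
    show "c = 0" if "const c * b \<in> M" for c using ind[rule_format, of "\<lambda>_. c" b] that b by simp
    show "\<exists>c. f - const c * b \<in> M" if "f \<in> graded_piece L (mdeg L u)" for f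
      using gen that b by auto
  qed
qed

lemma std_exists: "\<exists>v. std v \<and> mdeg L v = mdeg L u"
proof (rule ccontr)
  assume h: "\<not> (\<exists>v. std v \<and> mdeg L v = mdeg L u)"
  obtain b where b: "b \<in> graded_piece L (mdeg L u)" "\<And>c. const c * b \<in> M \<Longrightarrow> c = 0"
    using graded_piece_basis[of u] by metis
  have "b \<in> M" using h b(1) unfolding monomial_ideal_iff[OF monomial, of b] graded_piece_def by blast
  then have "const 1 * b \<in> M" by (simp add: const_def)
  with b(2) show False by fastforce
qed

lemma std_unique:
  assumes "std v" "std v'" "mdeg L v = mdeg L v'"
  shows "v = v'"
proof (rule ccontr)
  assume "v \<noteq> v'"
  obtain b where b: "\<And>f. f \<in> graded_piece L (mdeg L v) \<Longrightarrow> \<exists>c. f - const c * b \<in> M"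
    using graded_piece_basis[of v] by metis
  have "monom v \<in> graded_piece L (mdeg L v)" "monom v' \<in> graded_piece L (mdeg L v)"
    using assms(3) by (auto simp: graded_piece_def monom_def)
  then obtain c c' where c: "monom v - const c * b \<in> M" "monom v' - const c' * b \<in> M"
    using b by meson
  have "c' \<noteq> 0" using c(2) assms(2) by (auto simp: const_def)
  \<comment> \<open>Eliminates the basis element b; since c' is nonzero, x^v survives in an element
    of M.\<close>
  have "const c' * (monom v - const c * b) - const c * (monom v' - const c' * b) \<in> M"
    by (rule ideal.subspace_diff[OF M_subspace ideal.subspace_scale[OF M_subspace c(1)]
          ideal.subspace_scale[OF M_subspace c(2)]])
  also have "const c' * (monom v - const c * b) - const c * (monom v' - const c' * b) =
      const c' * monom v - const c * monom v'"
    by (simp add: right_diff_distrib mult.left_commute[of "const c'" "const c"])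
  also have "\<dots> = Poly_Mapping.single v c' - Poly_Mapping.single v' c"
    by (simp add: const_def monom_def mult_single)
  finally have "Poly_Mapping.single v c' - Poly_Mapping.single v' c \<in> M" .
  moreover have "v \<in> Poly_Mapping.keys (Poly_Mapping.single v c' - Poly_Mapping.single v' c)"
    using \<open>v \<noteq> v'\<close> \<open>c' \<noteq> 0\<close> by (simp add: in_keys_iff lookup_minus lookup_single when_def)
  ultimately show False using monomial_ideal_iff[OF monomial] assms(1) by blast
qed

definition D :: "(int^'n) set" where
  "D = {z \<in> L. std (pos z)}"

text \<open>\<open>D_down\<close> is closure of standard monomials under divisors;
  \<open>D_antisym\<close> and \<open>choice\<close> are uniqueness and existence of the standard
  monomial in each degree.\<close>

sublocale lattice_choice L D
proof
  show "0 \<in> L" using int_lattice.subspace_0[OF subspace_L] .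
  show "x + y \<in> L" if "x \<in> L" "y \<in> L" for x y using int_lattice.subspace_add[OF subspace_L that] .
  show "k *s x \<in> L" if "x \<in> L" for x k using int_lattice.subspace_scale[OF subspace_L that] .
  show "z \<in> L" if "z \<in> D" for z using that by (simp add: D_def)
  show "y \<in> D" if "p \<in> D" "y \<in> L" "\<And>i. y $ i \<le> max 0 (p $ i)" for p y
  proof -
    have "pos y \<le> pos p" using that(3) by (auto simp: less_eq_vec_def nat_le_iff le_max_iff_disj max_def)
    with that show ?thesis using std_down by (auto simp: D_def)
  qed
  show "z = 0" if "z \<in> D" "- z \<in> D" for z
  proof -
    have "mdeg L (pos (- z)) = mdeg L (pos z)"
      using that by (simp add: mdeg_eq_iff vint_pos_diff D_def)
    then have "pos (- z) = pos z" using that by (intro std_unique) (auto simp: D_def)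
    then show "z = 0" using vint_pos_diff[of z] by simp
  qed
  show "\<exists>q\<in>L. (\<forall>i. q $ i \<le> w $ i) \<and> (\<forall>y\<in>L. (\<forall>i. y $ i \<le> w $ i) \<longrightarrow> y - q \<in> D)"
    if "x \<in> L" "\<And>i. x $ i \<le> w $ i" for x w
  proof -
    define m where "m = pos (w - x)"
    have m: "vint m = w - x" using that(2) by (simp add: m_def vec_eq_iff)
    obtain v where v: "std v" "mdeg L v = mdeg L m" using std_exists by blast
    then have "vint m - vint v \<in> L" by (simp add: mdeg_eq_iff)
    then have "(vint m - vint v) + x \<in> L" using that(1) by (rule int_lattice.subspace_add[OF subspace_L])
    then have qL: "w - vint v \<in> L" by (simp add: m algebra_simps)
    have "y - (w - vint v) \<in> D" if y: "y \<in> L" "\<forall>i. y $ i \<le> w $ i" for y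
    proof -
      have "pos (y - (w - vint v)) \<le> v" using y(2) by (auto simp: less_eq_vec_def nat_le_iff)
      then show ?thesis using std_down[OF v(1)] int_lattice.subspace_diff[OF subspace_L y(1) qL]
        by (simp add: D_def)
    qed
    with qL show ?thesis by (intro bexI[of _ "w - vint v"]) auto
  qed
qed

section \<open>Minimal generators as lattice vectors\<close>

definition min_step :: "int^'n \<Rightarrow> bool" where
  "min_step z \<longleftrightarrow> z \<in> D \<and> pos (- z) \<in> min_gens M"

lemma step_props:
  assumes "z \<in> D" "z \<noteq> 0"
  shows "std (pos z)" "(monom (pos (- z)) :: ('n, 'k) mpoly) \<in> M"
    "mdeg L (pos z) = mdeg L (pos (- z))"
proof -
  show "std (pos z)" using assms by (simp add: D_def)
  show "(monom (pos (- z)) :: ('n, 'k) mpoly) \<in> M"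
    using assms D_antisym[of z] D_L[of z] uminus_L by (auto simp: D_def)
  show "mdeg L (pos z) = mdeg L (pos (- z))"
    unfolding mdeg_eq_iff using uminus_L[OF D_L[OF assms(1)]] vint_pos_diff[of "- z"] by simp
qed

lemma min_step_nonzero: "min_step z \<Longrightarrow> z \<noteq> 0"
proof
  assume "min_step z" "z = 0"
  then have "std (pos (- z))" "pos (- z) \<in> min_gens M" by (auto simp: min_step_def D_def)
  then show False using min_gens_iff[OF monomial] by blast
qed

lemma step_exists:
  assumes "(monom u :: ('n, 'k) mpoly) \<in> M" "std v" "mdeg L v = mdeg L u"
  shows "vint v - vint u \<in> D" "vint v - vint u \<noteq> 0" "pos (vint v - vint u) \<le> v"
    "pos (- (vint v - vint u)) \<le> u"
proof -
  show le: "pos (vint v - vint u) \<le> v" "pos (- (vint v - vint u)) \<le> u"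
    by (auto simp: less_eq_vec_def)
  have "vint v - vint u \<in> L" using assms(3) mdeg_eq_iff by metis
  then show "vint v - vint u \<in> D" using std_down[OF assms(2) le(1)] by (simp add: D_def)
  show "vint v - vint u \<noteq> 0" using assms by auto
qed

text \<open>Passing to v - u may cancel a common factor of x^u and x^v. What remains of x^u still
  lies in M, so minimality excludes any cancellation.\<close>

lemma step_of_min_gen:
  assumes "u \<in> min_gens M" "std v" "mdeg L v = mdeg L u"
  obtains z where "min_step z" "u = pos (- z)" "v = pos z"
proof -
  define z where "z = vint v - vint u"
  have uM: "(monom u :: ('n, 'k) mpoly) \<in> M" using assms(1) min_gens_iff[OF monomial] by blast
  note z = step_exists[OF uM assms(2,3), folded z_def]
  have u: "pos (- z) = u"
    using step_props(2)[OF z(1,2)] z(4) assms(1) unfolding min_gens_iff[OF monomial] by blast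
  have "vint (pos z) = vint v"
    using vint_pos_diff[of z] u by (simp add: z_def)
  then have "v = pos z" by simp
  moreover have "min_step z" unfolding min_step_def u using z(1) assms(1) by blast
  ultimately show thesis using that u by blast
qed

lemma min_step_minimal:
  assumes g: "min_step g" and h: "h \<in> D" "h \<noteq> 0" and le: "pos (- h) \<le> pos (- g)"
  shows "h = g"
proof -
  note gD = g[unfolded min_step_def, THEN conjunct1] and g0 = min_step_nonzero[OF g]
  have eq: "pos (- h) = pos (- g)"
    using g le step_props(2)[OF h] min_gens_iff[OF monomial, of "pos (- g)"] by (simp add: min_step_def)
  then have "mdeg L (pos h) = mdeg L (pos g)" using step_props(3)[OF h] step_props(3)[OF gD g0] by simp
  then have "pos h = pos g" using step_props(1)[OF h] step_props(1)[OF gD g0] std_unique by blast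
  with eq show ?thesis using vint_pos_diff by metis
qed

section \<open>Generators in the interior of the cone are not flippable\<close>

lemma not_flippable_sum:
  assumes b: "basis m m'" and mD: "m \<in> D" "m' \<in> D" and g: "min_step (m + m')"
  shows "\<not> flippable M (pos (- (m + m'))) (pos (m + m'))"
proof
  let ?g = "m + m'"
  let ?u = "pos (- ?g)" and ?v = "pos ?g"
  assume flip: "flippable M ?u ?v"
  note gD = g[unfolded min_step_def, THEN conjunct1] and g0 = min_step_nonzero[OF g]
  \<comment> \<open>Otherwise x^u would divide the standard monomial x^v. A negative coordinate
    supplies the term order.\<close>
  have "\<exists>i. ?g $ i < 0"
  proof (rule ccontr)
    assume "\<not> (\<exists>i. ?g $ i < 0)"
    then have "0 \<le> ?g $ i" for i by (simp add: not_less)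
    moreover have "nat (- x) \<le> nat x" if "0 \<le> x" for x :: int using that by simp
    ultimately have "pos (- ?g) $ i \<le> pos ?g $ i" for i
      unfolding pos_nth vector_uminus_component by blast
    then have "?u \<le> ?v" by (simp add: less_eq_vec_def)
    with step_props(1,2)[OF gD g0] std_down show False by blast
  qed
  then obtain i where "?g $ i < 0" by blast
  moreover have "nat x < nat (- x)" if "x < 0" for x :: int using that by simp
  ultimately have "?v $ i < ?u $ i" unfolding pos_nth vector_uminus_component by blast
  then obtain lt where lt: "term_order lt" "lt ?v ?u" using ex_term_order by blast
  have in_M: "initial_ideal lt (wall_ideal M ?u ?v) = M" using flip lt by (simp add: flippable_def)
  define s :: "nat^'n" where "s = (\<chi> i. nat (max (max 0 (m' $ i)) (?g $ i)))"
  have s: "vint s $ i = max (max 0 (m' $ i)) (?g $ i)" for i by (simp add: s_def)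
  obtain v where v: "std v" "mdeg L v = mdeg L s" using std_exists by blast
  define t where "t = vint s - vint v"
  have tL: "t \<in> L" using v(2) mdeg_eq_iff by (simp add: t_def)
  have "- t \<in> D"
  proof -
    have "pos (- t) \<le> v" by (auto simp: t_def less_eq_vec_def)
    then show ?thesis using std_down[OF v(1)] uminus_L[OF tL] by (simp add: D_def)
  qed
  moreover have "t $ i \<le> max (max 0 (m' $ i)) (?g $ i)" for i
    using s[of i] by (simp add: t_def)
  ultimately have "t = 0" using choice_at_zero[OF b mD gD tL] by blast
  then have std_s: "std s" using v(1) by (simp add: t_def)
  \<comment> \<open>m1 = s - g is the componentwise maximum of 0, -m and -g, so x^m1 is divisible by
    x^u and by a generator below m^-. Rewriting x^u to x^v turns x^m1 into x^s.\<close>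
  define m1 where "m1 = pos (vint s - ?g)"
  have m1: "vint m1 = vint s - ?g" using s by (simp add: m1_def vec_eq_iff)
  have m1_nth: "int (m1 $ i) = int (s $ i) - (m $ i + m' $ i)" and
    s_ge: "m' $ i \<le> int (s $ i)" "m $ i + m' $ i \<le> int (s $ i)" for i
    using arg_cong[OF m1, of "\<lambda>x. x $ i"] s[of i] by simp_all
  have m0: "m \<noteq> 0" "m' \<noteq> 0" using basis_nonzero[OF b] .
  obtain a where a: "a \<in> min_gens M" "a \<le> pos (- m)"
    using ex_min_gen_below[OF monomial step_props(2)[OF mD(1) m0(1)]] by blast
  \<comment> \<open>Needed because x^u is no longer a generator of the wall ideal. Equality would
    give g^- \<le> m^-, and then m - g = -m' would be in D.\<close>
  have "a \<noteq> ?u"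
  proof
    assume "a = ?u"
    have "- m' \<in> D"
    proof (rule D_down[OF mD(1) uminus_L[OF D_L[OF mD(2)]]])
      fix i
      have "nat (- (m $ i + m' $ i)) \<le> nat (- m $ i)"
        using a(2) \<open>a = ?u\<close> by (simp add: less_eq_vec_def)
      then show "(- m') $ i \<le> max 0 (m $ i)" by auto
    qed
    with D_antisym mD(2) m0(2) show False by blast
  qed
  have "a \<le> m1"
  proof -
    have "pos (- m) $ i \<le> m1 $ i" for i using m1_nth[of i] s_ge[of i] by simp
    with a(2) show ?thesis by (auto simp: less_eq_vec_def intro: order_trans)
  qed
  let ?W = "wall_ideal M ?u ?v :: ('n, 'k) mpoly set"
  have W: "ideal.subspace ?W" by (simp add: wall_ideal_def)
  have "(monom m1 :: ('n, 'k) mpoly) \<in> ideal.span (monom ` (min_gens M - {?u}))"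
    unfolding monom_in_span_iff using \<open>a \<le> m1\<close> \<open>a \<noteq> ?u\<close> a(1) by blast
  then have "(monom m1 :: ('n, 'k) mpoly) \<in> ?W"
    unfolding wall_ideal_def using ideal.span_mono[OF Un_upper1] by blast
  moreover have "monom ?u - monom ?v \<in> ?W" by (simp add: wall_ideal_def ideal.span_base)
  moreover have "(monom s :: ('n, 'k) mpoly) = monom m1 - monom (m1 - ?u) * (monom ?u - monom ?v)"
  proof -
    have "a - nat (- x) + nat (- x) = a" "a - nat (- x) + nat x = b" if "int a = int b - x" for a b x
      using that by linarith+
    from this[OF m1_nth] have 1: "(m1 - ?u) + ?u = m1" "(m1 - ?u) + ?v = s"
      unfolding vec_eq_iff by simp_all
    show ?thesis unfolding monom_def right_diff_distrib mult_single 1 by simp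
  qed
  ultimately have "(monom s :: ('n, 'k) mpoly) \<in> ?W"
    using ideal.subspace_diff[OF W] ideal.subspace_scale[OF W] by metis
  moreover have "is_leading_exp lt (monom s :: ('n, 'k) mpoly) s"
    by (auto simp: is_leading_exp_def monom_def)
  ultimately have "(monom s :: ('n, 'k) mpoly) \<in> initial_ideal lt ?W"
    unfolding initial_ideal_def by (intro ideal.span_base) blast
  with in_M std_s show False by simp
qed

section \<open>The two extreme vectors give flippable generators\<close>

text \<open>From -h \<le> max(0, -p), adding p gives p - h \<le> max(p, 0).\<close>

lemma D_diff:
  assumes p: "p \<in> D" and h: "h \<in> L" "pos (- h) \<le> pos (- p)"
  shows "p - h \<in> D"
proof (rule D_down[OF p diff_L[OF D_L[OF p] h(1)]])
  fix i
  have "nat (- h $ i) \<le> nat (- p $ i)" using h(2) by (simp add: less_eq_vec_def)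
  then show "(p - h) $ i \<le> max 0 (p $ i)" by auto
qed

text \<open>A monomial of M dividing x^(p^-) yields a step h such that both h and p - h lie in D,
  hence in the cone; this forces h = p.\<close>

lemma min_step_extreme:
  assumes b: "basis p q" and pD: "p \<in> D" and qD: "q \<in> D"
    and disj: "\<And>i. \<not> (p $ i < 0 \<and> q $ i < 0)"
  shows "min_step p"
proof -
  have p0: "p \<noteq> 0" using basis_nonzero[OF b] by blast
  have "a = pos (- p)" if a: "(monom a :: ('n, 'k) mpoly) \<in> M" "a \<le> pos (- p)" for a
  proof -
    obtain v where v: "std v" "mdeg L v = mdeg L a" using std_exists by blast
    define h where "h = vint v - vint a"
    note h = step_exists[OF a(1) v, folded h_def]
    have hL: "h \<in> L" using h(1) D_L by blast
    obtain x y where xy: "h = x *s p + y *s q" using basis_coords[OF b hL] .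
    have "0 \<le> x" "0 \<le> y"
      using disjoint_coords_nonneg[OF b pD qD disj, of x y]
        disjoint_coords_nonneg[OF basis_commute[OF b] qD pD, of y x] h(1) disj
      by (auto simp: xy add.commute)
    have "p - h \<in> D" using D_diff[OF pD hL] order_trans[OF h(4) a(2)] by blast
    also have "p - h = (1 - x) *s p + (- y) *s q" by (simp add: xy vec_eq_iff algebra_simps)
    finally have *: "(1 - x) *s p + (- y) *s q \<in> D" .
    then have "0 \<le> 1 - x" "0 \<le> - y"
      using disjoint_coords_nonneg[OF b pD qD disj *]
        disjoint_coords_nonneg[OF basis_commute[OF b] qD pD, of "- y" "1 - x"] disj
      by (auto simp: add.commute)
    with \<open>0 \<le> x\<close> \<open>0 \<le> y\<close> have "y = 0" "x = 0 \<or> x = 1" by auto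
    with h(2) have "h = p" by (auto simp: xy)
    with h(4) a(2) show "a = pos (- p)" by (metis order_antisym)
  qed
  then have "pos (- p) \<in> min_gens M"
    unfolding min_gens_iff[OF monomial] using step_props(2)[OF pD p0] by blast
  with pD show ?thesis by (simp add: min_step_def)
qed

text \<open>Summing the coefficients at the exponents s - k p, with k a natural number and s standard, is a
  linear functional that kills the wall ideal because p is extreme. For a polynomial with leading
  monomial s only the leading coefficient contributes.\<close>

lemma flippable_extreme:
  assumes b: "basis p q" and pD: "p \<in> D" and qD: "q \<in> D"
    and disj: "\<And>i. \<not> (p $ i < 0 \<and> q $ i < 0)"
  shows "flippable M (pos (- p)) (pos p)"
  unfolding flippable_def
proof (intro allI impI)
  fix lt :: "nat^'n \<Rightarrow> nat^'n \<Rightarrow> bool"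
  let ?u = "pos (- p)" and ?v = "pos p"
  assume "term_order lt \<and> lt ?v ?u"
  then have lt: "term_order lt" "lt ?v ?u" by auto
  let ?W = "wall_ideal M ?u ?v :: ('n, 'k) mpoly set"
  note p = min_step_extreme[OF b pD qD disj]
  have p0: "p \<noteq> 0" using basis_nonzero[OF b] by blast
  define on_ray where "on_ray s w \<longleftrightarrow> (\<exists>k::nat. vint w + int k *s p = vint s)" for s w
  \<comment> \<open>If h is the step of a, then k p - h lies below s and so in D. As h and k p - h
    are both in the cone, h has q-coordinate 0; minimality then gives h = p.\<close>
  have no_gen: "\<not> on_ray s (w + a)" if s: "std s" and a: "a \<in> min_gens M" "a \<noteq> ?u" for s w a
  proof
    assume "on_ray s (w + a)"
    then obtain k where k: "vint (w + a) + int k *s p = vint s" by (auto simp: on_ray_def)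
    have aM: "(monom a :: ('n, 'k) mpoly) \<in> M" using a min_gens_iff[OF monomial] by blast
    obtain v where v: "std v" "mdeg L v = mdeg L a" using std_exists by blast
    then obtain h where h: "min_step h" "a = pos (- h)" "v = pos h" using step_of_min_gen[OF a(1)] by blast
    have hD: "h \<in> D" using h by (simp add: min_step_def)
    obtain x y where xy: "h = x *s p + y *s q" using basis_coords[OF b D_L[OF hD]] .
    have kL: "int k *s p - h \<in> L" using D_L pD hD by (simp add: diff_L smult_L)
    have "pos (int k *s p - h) \<le> s"
    proof -
      have "int k * p $ i - h $ i \<le> int (s $ i)" for i
      proof -
        have "int (w $ i) + int (a $ i) + int k * p $ i = int (s $ i)"
          using arg_cong[OF k, of "\<lambda>x. x $ i"] by simp
        moreover have "- h $ i \<le> int (a $ i)" by (simp add: h(2))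
        ultimately show ?thesis by simp
      qed
      then show ?thesis by (auto simp: less_eq_vec_def nat_le_iff)
    qed
    then have "int k *s p - h \<in> D" using std_down[OF s] kL by (simp add: D_def)
    also have "int k *s p - h = (int k - x) *s p + (- y) *s q" by (simp add: xy vec_eq_iff algebra_simps)
    finally have *: "(- y) *s q + (int k - x) *s p \<in> D" by (simp add: add.commute)
    have "0 \<le> - y" using disjoint_coords_nonneg[OF basis_commute[OF b] qD pD _ *] disj by blast
    moreover have hD': "y *s q + x *s p \<in> D" using hD by (simp add: xy add.commute)
    then have "0 \<le> y" using disjoint_coords_nonneg[OF basis_commute[OF b] qD pD _ hD'] disj by blast
    ultimately have hx: "h = x *s p" by (simp add: xy)
    have "0 \<le> x" using disjoint_coords_nonneg[OF b pD qD disj, of x y] hD by (simp add: xy)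
    moreover have "x \<noteq> 0" using hx min_step_nonzero[OF h(1)] by auto
    ultimately have "1 \<le> x" by simp
    have "pos (- p) \<le> pos (- h)" unfolding hx by (rule neg_part_multiple) fact
    then have "p = h" using min_step_minimal[OF h(1) pD p0] by blast
    with h a show False by simp
  qed
  \<comment> \<open>As v = u + p, the parameter k shifts by one. Only k = 0 for w + u has no
    partner, and there x^u would divide the standard x^s.\<close>
  have ray_uv: "on_ray s (w + ?u) \<longleftrightarrow> on_ray s (w + ?v)" if s: "std s" for s w
  proof -
    have vu: "vint (w + ?v) = vint (w + ?u) + p" by (simp add: vec_eq_iff)
    have "vint (w + ?u) \<noteq> vint s"
    proof
      assume "vint (w + ?u) = vint s"
      then have "s = w + ?u" by simp
      then have "?u \<le> s" by (simp add: less_eq_vec_def)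
      with s std_down step_props(2)[OF pD p0] show False by blast
    qed
    moreover have "vint (w + ?u) + int (Suc k) *s p = vint (w + ?v) + int k *s p" for k
      unfolding vu by (simp add: vec_eq_iff algebra_simps)
    moreover have "vint (w + ?u) + int 0 *s p = vint (w + ?u)" by simp
    ultimately show ?thesis unfolding on_ray_def by (metis not0_implies_Suc)
  qed
  have vanish: "coeff_sum (on_ray s) f = 0" if s: "std s" and f: "f \<in> ?W" for s and f :: "('n, 'k) mpoly"
  proof -
    \<comment> \<open>The kernel of the functional need not be an ideal; quantifying over c gives
      the largest ideal inside it.\<close>
    let ?T = "{f :: ('n, 'k) mpoly. \<forall>c. coeff_sum (on_ray s) (c * f) = 0}"
    have "ideal.subspace ?T"
      by (rule ideal.subspaceI) (auto simp: coeff_sum_add distrib_left mult.assoc[symmetric])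
    moreover have "monom a \<in> ?T" if a: "a \<in> min_gens M - {?u}" for a
    proof (rule CollectI, rule allI)
      fix c :: "('n, 'k) mpoly"
      have "\<not> on_ray s w" if w: "w \<in> Poly_Mapping.keys (c * monom a)" for w
      proof -
        obtain w' where "w = w' + a"
          using keys_mult[of c "monom a"] w by (auto simp: monom_def split: if_splits)
        then show ?thesis using no_gen[OF s] a by blast
      qed
      then show "coeff_sum (on_ray s) (c * monom a) = 0" by (simp add: coeff_sum_def when_def)
    qed
    moreover have "monom ?u - monom ?v \<in> ?T"
    proof (rule CollectI, rule allI)
      fix c :: "('n, 'k) mpoly"
      have c: "c = (\<Sum>w\<in>Poly_Mapping.keys c. Poly_Mapping.single w (Poly_Mapping.lookup c w))"
        by (rule poly_mapping_eqI) (simp add: lookup_sum lookup_single when_def in_keys_iff)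
      have "coeff_sum (on_ray s) (Poly_Mapping.single w r * (monom ?u - monom ?v)) = 0"
        for w and r :: 'k
        using ray_uv[OF s, of w]
        by (simp add: monom_def right_diff_distrib mult_single coeff_sum_diff coeff_sum_single)
      then show "coeff_sum (on_ray s) (c * (monom ?u - monom ?v)) = 0"
        by (subst c) (simp add: sum_distrib_right coeff_sum_sum)
    qed
    ultimately have "?W \<subseteq> ?T" unfolding wall_ideal_def by (intro ideal.span_minimal) blast+
    with f have "coeff_sum (on_ray s) (1 * f) = 0" by blast
    then show ?thesis by simp
  qed
  have lead: "(monom s :: ('n, 'k) mpoly) \<in> M" if f: "f \<in> ?W" and s: "is_leading_exp lt f s"
    for s and f :: "('n, 'k) mpoly"
  proof (rule ccontr)
    assume std_s: "std s"
    have "\<not> on_ray s w" if w: "w \<in> Poly_Mapping.keys f" "w \<noteq> s" for w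
    proof
      assume "on_ray s w"
      then obtain k where k: "vint w + int k *s p = vint s" by (auto simp: on_ray_def)
      then have "k \<noteq> 0" using w(2) by (intro notI) simp
      have eq: "w + k *s ?v = s + k *s ?u"
      proof -
        have "vint (w + k *s ?v) = (vint w + int k *s p) + vint (k *s ?u)"
        proof -
          have "int k * int (nat (p $ i)) = int k * p $ i + int k * int (nat (- p $ i))" for i
            by (simp add: distrib_left[symmetric])
          then show ?thesis by (simp add: vec_eq_iff)
        qed
        also have "\<dots> = vint (s + k *s ?u)" unfolding k by (simp add: vec_eq_iff)
        finally show ?thesis by simp
      qed
      have "lt s w" using term_order_multiple[OF lt eq] \<open>k \<noteq> 0\<close> by simp
      moreover have "lt w s" using s w by (simp add: is_leading_exp_def)
      ultimately show False using lt(1) unfolding term_order_def transp_def irreflp_def by blast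
    qed
    then have "coeff_sum (on_ray s) f = (\<Sum>w\<in>Poly_Mapping.keys f. Poly_Mapping.lookup f w when w = s)"
      unfolding coeff_sum_def
      by (intro sum.cong) (auto simp: when_def on_ray_def intro: exI[of _ "0::nat"])
    also have "\<dots> = Poly_Mapping.lookup f s" by (simp add: when_def in_keys_iff)
    finally have "Poly_Mapping.lookup f s = 0" using vanish[OF std_s f] by simp
    with s show False by (simp add: is_leading_exp_def in_keys_iff)
  qed
  show "initial_ideal lt ?W = M"
  proof
    show "initial_ideal lt ?W \<subseteq> M"
      unfolding initial_ideal_def using lead by (intro ideal.span_minimal[OF _ M_subspace]) blast
    have "(monom a :: ('n, 'k) mpoly) \<in> initial_ideal lt ?W" if a: "a \<in> min_gens M" for a
    proof -
      have "\<exists>f\<in>?W. is_leading_exp lt f a"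
      proof (cases "a = ?u")
        case True
        have "?u \<noteq> ?v" using step_props[OF pD p0] by metis
        then have "is_leading_exp lt (monom ?u - monom ?v :: ('n, 'k) mpoly) a"
          using lt(2) True by (auto simp: is_leading_exp_def monom_def in_keys_iff lookup_minus
              lookup_single when_def split: if_splits)
        then show ?thesis by (intro bexI) (auto simp: wall_ideal_def intro: ideal.span_base)
      next
        case False
        then have "(monom a :: ('n, 'k) mpoly) \<in> ?W"
          unfolding wall_ideal_def using a by (intro ideal.span_base) blast
        moreover have "is_leading_exp lt (monom a :: ('n, 'k) mpoly) a"
          by (simp add: is_leading_exp_def monom_def)
        ultimately show ?thesis by blast
      qed
      then show ?thesis unfolding initial_ideal_def by (intro ideal.span_base) blast
    qed
    then have "ideal.span (monom ` min_gens M) \<subseteq> initial_ideal lt ?W"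
      by (intro ideal.span_minimal) (auto simp: initial_ideal_def)
    then show "M \<subseteq> initial_ideal lt ?W" using min_gens_span[OF monomial] by simp
  qed
qed

section \<open>Counting the flips\<close>

text \<open>Ensures that the two extreme vectors give two binomials. The exponent p^- is recognised
  as the one lying in M, and its degree determines p^+.\<close>

lemma monom_diff_inject:
  assumes "p \<in> D" "p \<noteq> 0" "q \<in> D" "q \<noteq> 0"
    and eq: "(monom (pos (- p)) - monom (pos p) :: ('n, 'k) mpoly) = monom (pos (- q)) - monom (pos q)"
  shows "p = q"
proof -
  note p = step_props[OF assms(1,2)] and q = step_props[OF assms(3,4)]
  have "pos (- p) \<noteq> pos p" "pos (- p) \<noteq> pos q" using p q by metis+
  with arg_cong[OF eq, of "\<lambda>f. Poly_Mapping.lookup f (pos (- p))"] have u: "pos (- p) = pos (- q)"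
    by (auto simp: monom_def lookup_minus lookup_single when_def split: if_splits)
  then have "pos p = pos q" using std_unique[OF p(1) q(1)] p(3) q(3) by simp
  with u show ?thesis using vint_pos_diff by metis
qed

lemma card_flips:
  assumes "basis e f"
  shows "card (flips L M) = 2"
proof -
  obtain p q where b: "basis p q" and pD: "p \<in> D" and qD: "q \<in> D"
    and disj: "\<And>i. \<not> (p $ i < 0 \<and> q $ i < 0)"
    using ex_basis_in_D[OF assms] ex_disjoint_basis by metis
  have b': "basis q p" and disj': "\<And>i. \<not> (q $ i < 0 \<and> p $ i < 0)"
    using basis_commute[OF b] disj by auto
  have p0: "p \<noteq> 0" "q \<noteq> 0" using basis_nonzero[OF b] .
  let ?F = "\<lambda>z. monom (pos (- z)) - monom (pos z) :: ('n, 'k) mpoly"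
  have flip: "?F z \<in> flips L M" if "min_step z" "flippable M (pos (- z)) (pos z)" for z
  proof -
    have "z \<in> D" "z \<noteq> 0" using that(1) min_step_nonzero by (auto simp: min_step_def)
    then have "is_flip L M (pos (- z)) (pos z)"
      using that step_props[of z] by (simp add: is_flip_def min_step_def)
    then show ?thesis by (auto simp: flips_def)
  qed
  have only: "z = p \<or> z = q" if z: "min_step z" and fl: "flippable M (pos (- z)) (pos z)" for z
  proof -
    have zD: "z \<in> D" using z by (simp add: min_step_def)
    obtain x y where xy: "z = x *s p + y *s q" using basis_coords[OF b D_L[OF zD]] .
    have "0 \<le> x" using disjoint_coords_nonneg[OF b pD qD disj, of x y] zD by (simp add: xy)
    have "0 \<le> y" using disjoint_coords_nonneg[OF b' qD pD disj', of y x] zD by (simp add: xy add.commute)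
    \<comment> \<open>Handles the boundary rays of the cone: a minimal generator on such a ray
      belongs to the extreme vector itself.\<close>
    have mult: "z = r" if "z = k *s r" "0 \<le> k" "r \<in> D" for k r
    proof -
      have "z \<noteq> 0" using min_step_nonzero[OF z] .
      then have "k \<noteq> 0" "r \<noteq> 0" using that(1) by auto
      with that(2) have "1 \<le> k" by simp
      then have "pos (- r) \<le> pos (- z)" unfolding that(1) by (rule neg_part_multiple)
      with min_step_minimal[OF z that(3) \<open>r \<noteq> 0\<close>] show "z = r" by simp
    qed
    consider "x = 0" | "y = 0" | "1 \<le> x" "1 \<le> y" using \<open>0 \<le> x\<close> \<open>0 \<le> y\<close> by linarith
    then show ?thesis
    proof cases
      case 1
      then show ?thesis using mult[of y q] \<open>0 \<le> y\<close> qD by (simp add: xy)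
    next
      case 2
      then show ?thesis using mult[of x p] \<open>0 \<le> x\<close> pD by (simp add: xy)
    next
      case 3
      have "h = z" if "h \<in> D" "h \<noteq> 0" "\<And>i. max 0 (- h $ i) \<le> max 0 (- z $ i)" for h
      proof -
        have "nat (- h $ i) \<le> nat (- z $ i)" for i using that(3)[of i] by linarith
        then have "pos (- h) \<le> pos (- z)" by (simp add: less_eq_vec_def)
        with min_step_minimal[OF z that(1,2)] show ?thesis by blast
      qed
      from decompose[OF b pD qD 3 xy zD this] obtain m m' where
        "basis m m'" "m \<in> D" "m' \<in> D" "z = m + m'" by blast
      with not_flippable_sum[of m m'] z fl show ?thesis by blast
    qed
  qed
  have "flips L M = {?F p, ?F q}"
  proof
    show "flips L M \<subseteq> {?F p, ?F q}"
    proof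
      fix x assume "x \<in> flips L M"
      then obtain u v where x: "x = monom u - monom v" and uv: "is_flip L M u v"
        unfolding flips_def by blast
      then obtain z where z: "min_step z" "u = pos (- z)" "v = pos z"
        using step_of_min_gen[of u v] unfolding is_flip_def by blast
      then have "z = p \<or> z = q" using only uv unfolding is_flip_def by blast
      with x z show "x \<in> {?F p, ?F q}" by blast
    qed
    show "{?F p, ?F q} \<subseteq> flips L M"
      using flip[OF min_step_extreme[OF b pD qD disj] flippable_extreme[OF b pD qD disj]]
        flip[OF min_step_extreme[OF b' qD pD disj'] flippable_extreme[OF b' qD pD disj']] by blast
  qed
  moreover have "p \<noteq> q"
    using basis_zero[OF b, of 1 "-1"] by auto
  then have "?F p \<noteq> ?F q" using monom_diff_inject[OF pD p0(1) qD p0(2)] by blast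
  ultimately show ?thesis by simp
qed

end

theorem corollary4p5:
  fixes L :: "(int^'n::finite) set"
    and M :: "('n, 'k::field) mpoly set"
  assumes "infinite (UNIV :: 'k set)"
    and "sublattice_of_rank L 2"
    and "monomial_ideal M"
    and "L_graded L M"
  shows "card (flips L M) = 2"
proof -
  obtain B where "card B = 2" and ind: "int_lattice.independent B" and span: "int_lattice.span B = L"
    using assms(2) by (auto simp: sublattice_of_rank_def)
  then obtain e f where B: "B = {e, f}" "e \<noteq> f" by (auto simp: card_2_iff)
  interpret monomial_graded_ideal L M
    using assms int_lattice.subspace_span[of B] by unfold_locales (simp_all add: span)
  have "basis e f"
    unfolding basis_def
  proof (intro conjI ballI allI impI)
    show "e \<in> L" "f \<in> L" unfolding span[symmetric] using B by (auto intro: int_lattice.span_base)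
    show "\<exists>a c. z = a *s e + c *s f" if "z \<in> L" for z
    proof -
      have "z \<in> int_lattice.span (insert e {f})" using that span B by simp
      then obtain a where "z - a *s e \<in> int_lattice.span {f}"
        unfolding int_lattice.span_insert by blast
      then obtain c where "z - a *s e = c *s f" unfolding int_lattice.span_singleton by blast
      then have "z = a *s e + c *s f" by (metis add.commute diff_add_cancel)
      then show ?thesis by blast
    qed
    fix a c assume 0: "a *s e + c *s f = 0"
    let ?u = "\<lambda>x. if x = e then a else c"
    have sum: "(\<Sum>x\<in>B. ?u x *s x) = 0" using B 0 by simp
    have "\<forall>x\<in>B. ?u x = 0"
    proof (rule ccontr)
      assume "\<not> (\<forall>x\<in>B. ?u x = 0)"
      then have "finite B \<and> B \<subseteq> B \<and> (\<Sum>x\<in>B. ?u x *s x) = 0 \<and> (\<exists>x\<in>B. ?u x \<noteq> 0)"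
        using sum B by blast
      then have "int_lattice.dependent B"
        unfolding int_lattice.dependent_explicit by (intro exI[of _ B] exI[of _ ?u])
      with ind show False by contradiction
    qed
    then show "a = 0" "c = 0" using B by auto
  qed
  then show ?thesis by (rule card_flips)
qed

end
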